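(* Let $n\in\{1,2,\dots,\infty\}$, let $\mathrm{k}$ be a separable real Hilbert space of dimension $n$, and let $\gamma^n$ be the free flow of rank $n$ on $\Phi(\mathrm{k})$. Then $\dim G(\gamma^n)=0$.
   Context: An $E_0$-semigroup on a von Neumann algebra $\mathrm{M}$ is a semigroup $(\alpha_t)_{t\ge 0}$ of normal unital $*$-endomorphisms of $\mathrm{M}$ with $\alpha_0=\mathrm{id}$, $\alpha_t(\mathrm{M})\ne \mathrm{M}$ for all $t>0$, and $t\mapsto\rho(\alpha_t(x))$ continuous for all $x\in\mathrm{M}$, $\rho\in\mathrm{M}_*$. A cocycle for $\alpha$ is a strongly continuous family of unitaries $(U_t)_{t\ge0}$ in $\mathrm{M}$ with $U_s\alpha_s(U_t)=U_{s+t}$ for all $s,t\ge 0$. Gauge index: for $\alpha$ on a $\mathrm{II}_1$ factor $\mathrm{M}$ with trace $\tau$, a gauge cocycle is a cocycle $U$ with $U_t\in\mathrm{M}\cap\alpha_t(\mathrm{M})'$ for all $t\ge0$; the gauge cocycles form a group $G(\alpha)$ under $(UV)_t=U_tV_t$. For $U,V\in G(\alpha)$ there is a unique $c_*(U,V)\in\mathbb{C}$ with $\tau(U_t^*V_t)=e^{c_*(U,V)t}$ for all $t\ge0$. The form $\langle f,g\rangle=\sum_{U,V}c_*(U,V)\overline{f(U)}g(V)$ is positive semidefinite on the space of finitely supported functions $f:G(\alpha)\to\mathbb{C}$ with $\sum_Uf(U)=0$; $H(G(\alpha))$ is the Hilbert space obtained by quotienting by null vectors and completing, and $\dim G(\alpha):=\dim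 H(G(\alpha))$. Free flow: let $\mathrm{k}^{\mathbb{C}}$ be the complexification of $\mathrm{k}$ and $\Gamma_f=\bigoplus_{m\ge0}L^2(\mathbb{R}_+;\mathrm{k}^{\mathbb{C}})^{\otimes m}$ the full Fock space with vacuum $\Omega$. For $f\in L^2(\mathbb{R}_+;\mathrm{k})$ let $l(f)\Omega=f$, $l(f)\xi=f\otimes\xi$ for $\xi\perp\Omega$, and $s(f)=(l(f)+l(f)^* )/2$. Then $\Phi(\mathrm{k})=\{s(f):f\in L^2(\mathbb{R}_+;\mathrm{k})\}''$ is a $\mathrm{II}_1$ factor isomorphic to $L(F_\infty)$, with $\Omega$ a cyclic and separating trace vector. With $(T_t)$ the unilateral shift semigroup, $(T_tf)(s)=0$ for $s<t$ and $f(s-t)$ for $s\ge t$, the free flow $\gamma^n$ of rank $n=\dim\mathrm{k}$ is the unique $E_0$-semigroup on $\Phi(\mathrm{k})$ with $\gamma^n_t(s(f))=s(T_tf)$ for all $f\in L^2(\mathbb{R}_+;\mathrm{k})$. *)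

theory Defs
  imports "HOL-Analysis.Analysis" "HOL-Library.Extended_Nat" "HOL-Library.FuncSet"
begin

section \<open>Complex Hilbert spaces\<close>

text \<open>Inner products are antilinear in the first argument.\<close>

class chilbert_space = real_inner + complete_space +
  fixes scaleC :: "complex \<Rightarrow> 'a \<Rightarrow> 'a" (infixr "*\<^sub>C" 75)
    and cinner :: "'a \<Rightarrow> 'a \<Rightarrow> complex"
  assumes scaleC_add_right: "c *\<^sub>C (x + y) = c *\<^sub>C x + c *\<^sub>C y"
    and scaleC_add_left: "(c + d) *\<^sub>C x = c *\<^sub>C x + d *\<^sub>C x"
    and scaleC_scaleC: "c *\<^sub>C (d *\<^sub>C x) = (c * d) *\<^sub>C x"
    and scaleC_of_real: "complex_of_real r *\<^sub>C x = r *\<^sub>R x"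
    and cinner_commute: "cinner x y = cnj (cinner y x)"
    and cinner_add_right: "cinner x (y + z) = cinner x y + cinner x z"
    and cinner_scaleC_right: "cinner x (c *\<^sub>C y) = c * cinner x y"
    and inner_eq_Re_cinner: "x \<bullet> y = Re (cinner x y)"

text \<open>
  The cardinality of an orthonormal basis, i.e. of a maximal orthonormal subset, of a real or
  complex Hilbert space with underlying set \<open>H\<close> and inner product \<open>ip\<close>; all infinite
  cardinalities are identified with \<open>\<infinity>\<close>.
\<close>

definition orthonormal_in :: "'a set \<Rightarrow> ('a \<Rightarrow> 'a \<Rightarrow> 'b::zero_neq_one) \<Rightarrow> 'a set \<Rightarrow> bool" where
  "orthonormal_in H ip E \<longleftrightarrow> E \<subseteq> H \<and> (\<forall>x\<in>E. \<forall>y\<in>E. ip x y = (if x = y then 1 else 0))"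

definition orthonormal_basis_of :: "'a set \<Rightarrow> ('a \<Rightarrow> 'a \<Rightarrow> 'b::zero_neq_one) \<Rightarrow> 'a set \<Rightarrow> bool" where
  "orthonormal_basis_of H ip E \<longleftrightarrow>
     orthonormal_in H ip E \<and> (\<forall>F. orthonormal_in H ip F \<and> E \<subseteq> F \<longrightarrow> F = E)"

definition hilbert_dim :: "'a set \<Rightarrow> ('a \<Rightarrow> 'a \<Rightarrow> 'b::zero_neq_one) \<Rightarrow> enat" where
  "hilbert_dim H ip =
     (let E = (SOME E. orthonormal_basis_of H ip E) in if finite E then enat (card E) else \<infinity>)"


section \<open>Hilbert spaces obtained from positive semidefinite kernels\<close>

definition finsupp :: "'x set \<Rightarrow> ('x \<Rightarrow> complex) set" where
  "finsupp X = {f. finite {u. f u \<noteq> 0} \<and> {u. f u \<noteq> 0} \<subseteq> X}"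

definition kform :: "('x \<Rightarrow> 'x \<Rightarrow> complex) \<Rightarrow> ('x \<Rightarrow> complex) \<Rightarrow> ('x \<Rightarrow> complex) \<Rightarrow> complex" where
  "kform K f g = (\<Sum>u | f u \<noteq> 0. \<Sum>v | g v \<noteq> 0. K u v * cnj (f u) * g v)"

definition knorm :: "('x \<Rightarrow> 'x \<Rightarrow> complex) \<Rightarrow> ('x \<Rightarrow> complex) \<Rightarrow> real" where
  "knorm K f = sqrt (Re (kform K f f))"

text \<open>
  Let \<open>V\<close> be a space of finitely supported functions on which \<open>kform K\<close> is positive semidefinite.
  Quotienting \<open>V\<close> by the null vectors and completing is carried out in one step: the elements of
  \<open>khilbert V K\<close> are the Cauchy sequences in \<open>V\<close> for the seminorm \<open>knorm K\<close>, two of them being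
  identified if their difference tends to \<open>0\<close> in this seminorm. A vector of \<open>V\<close> is represented
  by the constant sequence, and constant sequences are identified precisely when they differ
  by a null vector.
\<close>

definition kCauchy :: "('x \<Rightarrow> complex) set \<Rightarrow> ('x \<Rightarrow> 'x \<Rightarrow> complex) \<Rightarrow> (nat \<Rightarrow> 'x \<Rightarrow> complex) \<Rightarrow> bool" where
  "kCauchy V K s \<longleftrightarrow> (\<forall>n. s n \<in> V) \<and>
     (\<forall>e>0. \<exists>N. \<forall>m\<ge>N. \<forall>n\<ge>N. knorm K (\<lambda>u. s m u - s n u) < e)"

definition krel :: "('x \<Rightarrow> complex) set \<Rightarrow> ('x \<Rightarrow> 'x \<Rightarrow> complex) \<Rightarrow>
    (nat \<Rightarrow> 'x \<Rightarrow> complex) \<Rightarrow> (nat \<Rightarrow> 'x \<Rightarrow> complex) \<Rightarrow> bool" where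
  "krel V K s t \<longleftrightarrow> kCauchy V K s \<and> kCauchy V K t \<and>
     (\<lambda>n. knorm K (\<lambda>u. s n u - t n u)) \<longlonglongrightarrow> 0"

definition khilbert :: "('x \<Rightarrow> complex) set \<Rightarrow> ('x \<Rightarrow> 'x \<Rightarrow> complex) \<Rightarrow> (nat \<Rightarrow> 'x \<Rightarrow> complex) set set" where
  "khilbert V K = {s. kCauchy V K s} // {(s, t). krel V K s t}"

definition klim :: "('x \<Rightarrow> 'x \<Rightarrow> complex) \<Rightarrow> (nat \<Rightarrow> 'x \<Rightarrow> complex) \<Rightarrow> (nat \<Rightarrow> 'x \<Rightarrow> complex) \<Rightarrow> complex" where
  "klim K s t = lim (\<lambda>n. kform K (s n) (t n))"

definition kinner :: "('x \<Rightarrow> 'x \<Rightarrow> complex) \<Rightarrow>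
    (nat \<Rightarrow> 'x \<Rightarrow> complex) set \<Rightarrow> (nat \<Rightarrow> 'x \<Rightarrow> complex) set \<Rightarrow> complex" where
  "kinner K p q = klim K (SOME s. s \<in> p) (SOME t. t \<in> q)"

locale psd_kernel =
  fixes X :: "'x set" and K :: "'x \<Rightarrow> 'x \<Rightarrow> complex"
  assumes herm: "\<And>u v. u \<in> X \<Longrightarrow> v \<in> X \<Longrightarrow> K u v = cnj (K v u)"
    and psd: "\<And>f. f \<in> finsupp X \<Longrightarrow> 0 \<le> Re (kform K f f)"
begin

lemma kform_eq:
  assumes "finite A" "{u. f u \<noteq> 0} \<subseteq> A" "{u. g u \<noteq> 0} \<subseteq> A"
  shows "kform K f g = (\<Sum>u\<in>A. \<Sum>v\<in>A. K u v * cnj (f u) * g v)"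
proof -
  have "kform K f g = (\<Sum>u | f u \<noteq> 0. \<Sum>v\<in>A. K u v * cnj (f u) * g v)"
    unfolding kform_def using assms
    by (intro sum.cong sum.mono_neutral_left) auto
  also have "\<dots> = (\<Sum>u\<in>A. \<Sum>v\<in>A. K u v * cnj (f u) * g v)"
    using assms by (intro sum.mono_neutral_left) auto
  finally show ?thesis .
qed

lemma fs_add: "f \<in> finsupp X \<Longrightarrow> g \<in> finsupp X \<Longrightarrow> (\<lambda>u. f u + g u) \<in> finsupp X"
  unfolding finsupp_def
  by (force intro: finite_subset[of _ "{u. f u \<noteq> 0} \<union> {u. g u \<noteq> 0}"])

lemma fs_scale: "f \<in> finsupp X \<Longrightarrow> (\<lambda>u. c * f u) \<in> finsupp X"
  unfolding finsupp_def
  by (auto intro: finite_subset[of _ "{u. f u \<noteq> 0}"])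

lemma fs_diff: "f \<in> finsupp X \<Longrightarrow> g \<in> finsupp X \<Longrightarrow> (\<lambda>u. f u - g u) \<in> finsupp X"
  unfolding finsupp_def
  by (force intro: finite_subset[of _ "{u. f u \<noteq> 0} \<union> {u. g u \<noteq> 0}"])

lemma fs_zero: "(\<lambda>u. 0) \<in> finsupp X"
  unfolding finsupp_def by auto

lemma kform_add_right:
  assumes "f \<in> finsupp X" "g \<in> finsupp X" "h \<in> finsupp X"
  shows "kform K f (\<lambda>u. g u + h u) = kform K f g + kform K f h"
proof -
  let ?A = "{u. f u \<noteq> 0} \<union> {u. g u \<noteq> 0} \<union> {u. h u \<noteq> 0}"
  have A: "finite ?A" using assms unfolding finsupp_def by auto
  show ?thesis
    by (subst (1 2 3) kform_eq[OF A]) (auto simp: sum.distrib algebra_simps)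
qed

lemma kform_scale_right:
  assumes "f \<in> finsupp X" "g \<in> finsupp X"
  shows "kform K f (\<lambda>u. c * g u) = c * kform K f g"
proof -
  let ?A = "{u. f u \<noteq> 0} \<union> {u. g u \<noteq> 0}"
  have A: "finite ?A" using assms unfolding finsupp_def by auto
  show ?thesis
    by (subst (1 2) kform_eq[OF A]) (auto simp: sum_distrib_left algebra_simps)
qed

lemma kform_herm:
  assumes "f \<in> finsupp X" "g \<in> finsupp X"
  shows "kform K f g = cnj (kform K g f)"
proof -
  have "cnj (kform K g f) = (\<Sum>u | g u \<noteq> 0. \<Sum>v | f v \<noteq> 0. cnj (K u v) * g u * cnj (f v))"
    unfolding kform_def by simp
  also have "\<dots> = (\<Sum>u | g u \<noteq> 0. \<Sum>v | f v \<noteq> 0. K v u * cnj (f v) * g u)"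
    using assms unfolding finsupp_def
    by (intro sum.cong refl) (subst herm, auto)
  also have "\<dots> = kform K f g" unfolding kform_def by (rule sum.swap)
  finally show ?thesis by simp
qed

lemma kform_add_left:
  assumes "f \<in> finsupp X" "g \<in> finsupp X" "h \<in> finsupp X"
  shows "kform K (\<lambda>u. g u + h u) f = kform K g f + kform K h f"
  by (subst (1 2 3) kform_herm) (auto simp: assms fs_add kform_add_right)

lemma kform_scale_left:
  assumes "f \<in> finsupp X" "g \<in> finsupp X"
  shows "kform K (\<lambda>u. c * g u) f = cnj c * kform K g f"
  by (subst (1 2) kform_herm) (auto simp: assms fs_scale kform_scale_right)

lemma kform_diff_right:
  assumes "f \<in> finsupp X" "g \<in> finsupp X" "h \<in> finsupp X"
  shows "kform K f (\<lambda>u. g u - h u) = kform K f g - kform K f h"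
  using kform_add_right[OF assms(1,2) fs_scale[OF assms(3), of "-1"]]
    kform_scale_right[OF assms(1,3), of "-1"] by simp

lemma kform_diff_left:
  assumes "f \<in> finsupp X" "g \<in> finsupp X" "h \<in> finsupp X"
  shows "kform K (\<lambda>u. g u - h u) f = kform K g f - kform K h f"
  by (subst (1 2 3) kform_herm) (auto simp: assms fs_diff kform_diff_right)

lemma kform_self_real: "f \<in> finsupp X \<Longrightarrow> kform K f f = of_real (Re (kform K f f))"
  using kform_herm[of f f] by (auto simp: complex_eq_iff)

lemma knorm_nonneg: "f \<in> finsupp X \<Longrightarrow> 0 \<le> knorm K f"
  unfolding knorm_def using psd by auto

lemma knorm_sq: "f \<in> finsupp X \<Longrightarrow> (knorm K f)\<^sup>2 = Re (kform K f f)"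
  unfolding knorm_def using psd by auto

lemma knorm_scale:
  assumes "f \<in> finsupp X" shows "knorm K (\<lambda>u. c * f u) = cmod c * knorm K f"
proof -
  have "kform K (\<lambda>u. c * f u) (\<lambda>u. c * f u) = (cnj c * c) * kform K f f"
    using assms by (simp add: kform_scale_left kform_scale_right fs_scale)
  also have "cnj c * c = of_real ((cmod c)\<^sup>2)"
    by (metis complex_norm_square mult.commute)
  finally have "Re (kform K (\<lambda>u. c * f u) (\<lambda>u. c * f u)) = (cmod c)\<^sup>2 * Re (kform K f f)"
    by (simp del: of_real_power)
  then show ?thesis unfolding knorm_def by (simp add: real_sqrt_mult)
qed

lemma expand_add:
  assumes "f \<in> finsupp X" "g \<in> finsupp X"
  shows "Re (kform K (\<lambda>u. f u + g u) (\<lambda>u. f u + g u))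
    = Re (kform K f f) + 2 * Re (kform K f g) + Re (kform K g g)"
proof -
  have "Re (kform K g f) = Re (kform K f g)"
    by (subst kform_herm) (auto simp: assms)
  then show ?thesis
    using assms by (simp add: kform_add_left kform_add_right fs_add)
qed

lemma Cauchy_Schwarz:
  assumes f: "f \<in> finsupp X" and g: "g \<in> finsupp X"
  shows "cmod (kform K f g) \<le> knorm K f * knorm K g"
proof -
  define a b c where "a = Re (kform K f f)" and "b = kform K f g" and "c = Re (kform K g g)"
  have a0: "a \<ge> 0" and c0: "c \<ge> 0" using psd f g by (auto simp: a_def c_def)
  have key: "0 \<le> a + 2 * t * (cmod b)\<^sup>2 + t\<^sup>2 * (cmod b)\<^sup>2 * c" for t :: real
  proof -
    let ?m = "of_real t * cnj b"
    have mg: "(\<lambda>u. ?m * g u) \<in> finsupp X" using g by (rule fs_scale)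
    have "0 \<le> Re (kform K (\<lambda>u. f u + ?m * g u) (\<lambda>u. f u + ?m * g u))"
      by (intro psd fs_add f mg)
    also have "\<dots> = a + 2 * Re (?m * b) + Re (kform K (\<lambda>u. ?m * g u) (\<lambda>u. ?m * g u))"
      by (subst expand_add[OF f mg], subst kform_scale_right[OF f g]) (simp only: a_def b_def)
    also have "Re (kform K (\<lambda>u. ?m * g u) (\<lambda>u. ?m * g u)) = t\<^sup>2 * (cmod b)\<^sup>2 * c"
      using knorm_sq[OF mg] knorm_sq[OF g]
      by (simp add: knorm_scale g c_def norm_mult power_mult_distrib)
    also have "Re (?m * b) = t * (cmod b)\<^sup>2"
      unfolding cmod_power2 by (simp add: algebra_simps power2_eq_square)
    finally show ?thesis by simp
  qed
  have "(cmod b)\<^sup>2 \<le> a * c"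
  proof (cases "c = 0")
    case True
    show ?thesis
    proof (rule ccontr)
      assume "\<not> ?thesis"
      then have b: "(cmod b)\<^sup>2 > 0" using True by simp
      have "0 \<le> a + 2 * (- (a + 1) / (cmod b)\<^sup>2) * (cmod b)\<^sup>2"
        using key[of "- (a + 1) / (cmod b)\<^sup>2"] True by simp
      also have "\<dots> = a - 2 * (a + 1)" using b by (simp add: field_simps)
      finally show False using a0 by simp
    qed
  next
    case False
    then have c: "c > 0" using c0 by simp
    have "0 \<le> a + 2 * (-1/c) * (cmod b)\<^sup>2 + (-1/c)\<^sup>2 * (cmod b)\<^sup>2 * c" by (rule key)
    also have "\<dots> = a - (cmod b)\<^sup>2 / c" using c by (simp add: field_simps power2_eq_square)
    finally show ?thesis using c by (simp add: field_simps)
  qed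
  then have "sqrt ((cmod b)\<^sup>2) \<le> sqrt (a * c)" by (rule real_sqrt_le_mono)
  then show ?thesis by (simp add: real_sqrt_mult knorm_def a_def b_def c_def)
qed

lemma knorm_triangle:
  assumes f: "f \<in> finsupp X" and g: "g \<in> finsupp X"
  shows "knorm K (\<lambda>u. f u + g u) \<le> knorm K f + knorm K g"
proof (rule power2_le_imp_le)
  show "0 \<le> knorm K f + knorm K g" using f g by (simp add: knorm_nonneg)
  have "Re (kform K f g) \<le> knorm K f * knorm K g"
    using Cauchy_Schwarz[OF f g] complex_Re_le_cmod order_trans by blast
  then show "(knorm K (\<lambda>u. f u + g u))\<^sup>2 \<le> (knorm K f + knorm K g)\<^sup>2"
    using f g by (simp add: knorm_sq fs_add expand_add power2_sum)
qed

lemma knorm_minus_commute: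
  assumes "f \<in> finsupp X" "g \<in> finsupp X"
  shows "knorm K (\<lambda>u. f u - g u) = knorm K (\<lambda>u. g u - f u)"
  using knorm_scale[OF fs_diff[OF assms], of "-1"] by simp

lemma knorm_triangle_diff:
  assumes "f \<in> finsupp X" "g \<in> finsupp X" "h \<in> finsupp X"
  shows "knorm K (\<lambda>u. f u - h u) \<le> knorm K (\<lambda>u. f u - g u) + knorm K (\<lambda>u. g u - h u)"
  using knorm_triangle[OF fs_diff[OF assms(1,2)] fs_diff[OF assms(2,3)]] by simp

lemma knorm_zero: "knorm K (\<lambda>u. 0) = 0"
  by (simp add: knorm_def kform_def)

abbreviation "Cs \<equiv> kCauchy (finsupp X) K"
abbreviation "Rl \<equiv> krel (finsupp X) K"

lemma CsD: "Cs s \<Longrightarrow> s n \<in> finsupp X"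
  by (simp add: kCauchy_def)

lemma Cs_const: "f \<in> finsupp X \<Longrightarrow> Cs (\<lambda>_. f)"
  by (simp add: kCauchy_def knorm_zero)

lemma Rl_refl: "Cs s \<Longrightarrow> Rl s s"
  by (simp add: krel_def knorm_zero)

lemma Rl_sym: "Rl s t \<Longrightarrow> Rl t s"
  by (auto simp: krel_def knorm_minus_commute[OF CsD CsD])

lemma Rl_trans:
  assumes "Rl s t" "Rl t r" shows "Rl s r"
proof -
  have C: "Cs s" "Cs t" "Cs r" using assms by (auto simp: krel_def)
  have "(\<lambda>n. knorm K (\<lambda>u. s n u - t n u) + knorm K (\<lambda>u. t n u - r n u)) \<longlonglongrightarrow> 0 + 0"
    using assms by (intro tendsto_add) (auto simp: krel_def)
  then have L: "(\<lambda>n. knorm K (\<lambda>u. s n u - t n u) + knorm K (\<lambda>u. t n u - r n u)) \<longlonglongrightarrow> 0"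
    by simp
  have "(\<lambda>n. knorm K (\<lambda>u. s n u - r n u)) \<longlonglongrightarrow> 0"
    by (rule Lim_null_comparison[OF always_eventually L])
      (auto intro!: knorm_triangle_diff simp: knorm_nonneg fs_diff CsD C)
  then show ?thesis using C by (simp add: krel_def)
qed

lemma Rl_part_equivp: "part_equivp Rl"
proof (rule part_equivpI)
  show "\<exists>s. Rl s s" using Rl_refl Cs_const fs_zero by blast
  show "symp Rl" by (auto intro: sympI Rl_sym)
  show "transp Rl" by (auto intro: transpI Rl_trans)
qed

lemma Cs_add:
  assumes s: "Cs s" and t: "Cs t" shows "Cs (\<lambda>n u. s n u + t n u)"
  unfolding kCauchy_def
proof (intro conjI allI impI)
  show "(\<lambda>u. s n u + t n u) \<in> finsupp X" for n using s t by (intro fs_add CsD)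
  fix e :: real assume "e > 0"
  then have e: "e/2 > 0" by simp
  obtain N1 where N1: "\<And>m n. m \<ge> N1 \<Longrightarrow> n \<ge> N1 \<Longrightarrow> knorm K (\<lambda>u. s m u - s n u) < e/2"
    using s e unfolding kCauchy_def by blast
  obtain N2 where N2: "\<And>m n. m \<ge> N2 \<Longrightarrow> n \<ge> N2 \<Longrightarrow> knorm K (\<lambda>u. t m u - t n u) < e/2"
    using t e unfolding kCauchy_def by blast
  show "\<exists>N. \<forall>m\<ge>N. \<forall>n\<ge>N. knorm K (\<lambda>u. s m u + t m u - (s n u + t n u)) < e"
  proof (intro exI[of _ "max N1 N2"] allI impI)
    fix m n assume mn: "max N1 N2 \<le> m" "max N1 N2 \<le> n"
    have "(\<lambda>u. s m u + t m u - (s n u + t n u)) = (\<lambda>u. (s m u - s n u) + (t m u - t n u))"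
      by auto
    then have "knorm K (\<lambda>u. s m u + t m u - (s n u + t n u))
        = knorm K (\<lambda>u. (s m u - s n u) + (t m u - t n u))" by simp
    also have "\<dots> \<le> knorm K (\<lambda>u. s m u - s n u) + knorm K (\<lambda>u. t m u - t n u)"
      by (intro knorm_triangle fs_diff CsD s t)
    also have "\<dots> < e" using N1[of m n] N2[of m n] mn by simp
    finally show "knorm K (\<lambda>u. s m u + t m u - (s n u + t n u)) < e" .
  qed
qed

lemma Cs_scale:
  assumes s: "Cs s" shows "Cs (\<lambda>n u. c * s n u)"
  unfolding kCauchy_def
proof (intro conjI allI impI)
  show "(\<lambda>u. c * s n u) \<in> finsupp X" for n using s by (intro fs_scale CsD)
  fix e :: real assume "e > 0"
  then have e: "e / (cmod c + 1) > 0" by (simp add: add_nonneg_pos)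
  have pos: "cmod c + 1 > 0" by (simp add: add_nonneg_pos)
  obtain N where N: "\<And>m n. m \<ge> N \<Longrightarrow> n \<ge> N \<Longrightarrow> knorm K (\<lambda>u. s m u - s n u) < e / (cmod c + 1)"
    using s e unfolding kCauchy_def by blast
  show "\<exists>N. \<forall>m\<ge>N. \<forall>n\<ge>N. knorm K (\<lambda>u. c * s m u - c * s n u) < e"
  proof (intro exI[of _ N] allI impI)
    fix m n assume mn: "N \<le> m" "N \<le> n"
    have nn: "0 \<le> knorm K (\<lambda>u. s m u - s n u)" by (intro knorm_nonneg fs_diff CsD s)
    have "knorm K (\<lambda>u. c * s m u - c * s n u) = cmod c * knorm K (\<lambda>u. s m u - s n u)"
      using knorm_scale[OF fs_diff[OF CsD[OF s] CsD[OF s]], of c m n] by (simp add: right_diff_distrib)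
    also have "\<dots> \<le> (cmod c + 1) * knorm K (\<lambda>u. s m u - s n u)"
      using nn by (simp add: mult_right_mono)
    also have "\<dots> < e" using N[OF mn] pos by (simp add: field_simps)
    finally show "knorm K (\<lambda>u. c * s m u - c * s n u) < e" .
  qed
qed

lemma Rl_add:
  assumes "Rl s s'" "Rl t t'" shows "Rl (\<lambda>n u. s n u + t n u) (\<lambda>n u. s' n u + t' n u)"
proof -
  have C: "Cs s" "Cs s'" "Cs t" "Cs t'" using assms by (auto simp: krel_def)
  have "(\<lambda>n. knorm K (\<lambda>u. s n u - s' n u) + knorm K (\<lambda>u. t n u - t' n u)) \<longlonglongrightarrow> 0 + 0"
    using assms by (intro tendsto_add) (auto simp: krel_def)
  then have L: "(\<lambda>n. knorm K (\<lambda>u. s n u - s' n u) + knorm K (\<lambda>u. t n u - t' n u)) \<longlonglongrightarrow> 0"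
    by simp
  have "(\<lambda>n. knorm K (\<lambda>u. (s n u + t n u) - (s' n u + t' n u))) \<longlonglongrightarrow> 0"
  proof (rule Lim_null_comparison[OF always_eventually L], intro allI)
    fix n
    have "(\<lambda>u. (s n u + t n u) - (s' n u + t' n u)) = (\<lambda>u. (s n u - s' n u) + (t n u - t' n u))"
      by auto
    then show "norm (knorm K (\<lambda>u. (s n u + t n u) - (s' n u + t' n u)))
        \<le> knorm K (\<lambda>u. s n u - s' n u) + knorm K (\<lambda>u. t n u - t' n u)"
      by (auto intro!: knorm_triangle simp: knorm_nonneg fs_diff fs_add CsD C)
  qed
  then show ?thesis using C by (simp add: krel_def Cs_add)
qed

lemma Rl_scale:
  assumes "Rl s s'" shows "Rl (\<lambda>n u. c * s n u) (\<lambda>n u. c * s' n u)"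
proof -
  have C: "Cs s" "Cs s'" using assms by (auto simp: krel_def)
  have "(\<lambda>n. cmod c * knorm K (\<lambda>u. s n u - s' n u)) \<longlonglongrightarrow> cmod c * 0"
    using assms by (intro tendsto_mult tendsto_const) (auto simp: krel_def)
  moreover have "knorm K (\<lambda>u. c * s n u - c * s' n u) = cmod c * knorm K (\<lambda>u. s n u - s' n u)" for n
    using knorm_scale[OF fs_diff[OF CsD[OF C(1)] CsD[OF C(2)]], of c n n]
    by (simp add: right_diff_distrib)
  ultimately show ?thesis using C by (simp add: krel_def Cs_scale)
qed

lemma Cs_bounded:
  assumes s: "Cs s" obtains b where "b > 0" "\<And>n. knorm K (s n) \<le> b"
proof -
  obtain N where N: "\<And>m n. m \<ge> N \<Longrightarrow> n \<ge> N \<Longrightarrow> knorm K (\<lambda>u. s m u - s n u) < 1"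
    using s zero_less_one[where 'a=real] unfolding kCauchy_def by blast
  let ?b = "1 + (\<Sum>n\<le>N. knorm K (s n))"
  have nn: "0 \<le> knorm K (s n)" for n using s by (intro knorm_nonneg CsD)
  have le: "knorm K (s n) \<le> (\<Sum>n\<le>N. knorm K (s n))" if "n \<le> N" for n
    using that nn by (intro member_le_sum) auto
  have "knorm K (s n) \<le> ?b" for n
  proof (cases "n \<le> N")
    case True then show ?thesis using le[of n] by simp
  next
    case False
    have "knorm K (s n) \<le> knorm K (\<lambda>u. s n u - s N u) + knorm K (s N)"
      using knorm_triangle[OF fs_diff[OF CsD[OF s] CsD[OF s]] CsD[OF s], of n N N] by simp
    also have "\<dots> \<le> ?b" using N[of n N] False le[of N] by simp
    finally show ?thesis .
  qed
  moreover have "?b > 0" using nn by (simp add: add_pos_nonneg sum_nonneg)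
  ultimately show thesis using that by blast
qed

lemma kform_diff_bound:
  assumes "f \<in> finsupp X" "f' \<in> finsupp X" "g \<in> finsupp X" "g' \<in> finsupp X"
  shows "cmod (kform K f g - kform K f' g')
    \<le> knorm K (\<lambda>u. f u - f' u) * knorm K g + knorm K f' * knorm K (\<lambda>u. g u - g' u)"
proof -
  have "kform K f g - kform K f' g' = kform K (\<lambda>u. f u - f' u) g + kform K f' (\<lambda>u. g u - g' u)"
    using assms by (simp add: kform_diff_left kform_diff_right)
  also have "cmod \<dots> \<le> cmod (kform K (\<lambda>u. f u - f' u) g) + cmod (kform K f' (\<lambda>u. g u - g' u))"
    by (rule norm_triangle_ineq)
  also have "\<dots> \<le> knorm K (\<lambda>u. f u - f' u) * knorm K g + knorm K f' * knorm K (\<lambda>u. g u - g' u)"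
    by (intro add_mono Cauchy_Schwarz fs_diff assms)
  finally show ?thesis .
qed

lemma kform_Cauchy:
  assumes s: "Cs s" and t: "Cs t" shows "Cauchy (\<lambda>n. kform K (s n) (t n))"
proof (rule metric_CauchyI)
  fix e :: real assume e: "e > 0"
  obtain b where b: "b > 0" "\<And>n. knorm K (s n) \<le> b" using Cs_bounded[OF s] by blast
  obtain c where c: "c > 0" "\<And>n. knorm K (t n) \<le> c" using Cs_bounded[OF t] by blast
  have bc: "e / (2 * c) > 0" "e / (2 * b) > 0" using b c e by auto
  obtain N1 where N1: "\<And>m n. m \<ge> N1 \<Longrightarrow> n \<ge> N1 \<Longrightarrow> knorm K (\<lambda>u. s m u - s n u) < e / (2 * c)"
    using s bc unfolding kCauchy_def by blast
  obtain N2 where N2: "\<And>m n. m \<ge> N2 \<Longrightarrow> n \<ge> N2 \<Longrightarrow> knorm K (\<lambda>u. t m u - t n u) < e / (2 * b)"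
    using t bc unfolding kCauchy_def by blast
  show "\<exists>M. \<forall>m\<ge>M. \<forall>n\<ge>M. dist (kform K (s m) (t m)) (kform K (s n) (t n)) < e"
  proof (intro exI[of _ "max N1 N2"] allI impI)
    fix m n assume mn: "max N1 N2 \<le> m" "max N1 N2 \<le> n"
    have "dist (kform K (s m) (t m)) (kform K (s n) (t n))
      \<le> knorm K (\<lambda>u. s m u - s n u) * knorm K (t m) + knorm K (s n) * knorm K (\<lambda>u. t m u - t n u)"
      unfolding dist_norm using s t by (intro kform_diff_bound CsD)
    also have "\<dots> \<le> knorm K (\<lambda>u. s m u - s n u) * c + b * knorm K (\<lambda>u. t m u - t n u)"
      using s t b c by (intro add_mono mult_mono) (auto intro!: knorm_nonneg fs_diff simp: CsD)
    also have "\<dots> < (e / (2 * c)) * c + b * (e / (2 * b))"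
      using N1[of m n] N2[of m n] mn b c
      by (intro add_strict_mono mult_strict_right_mono mult_strict_left_mono) auto
    also have "\<dots> = e" using b c by (simp add: field_simps)
    finally show "dist (kform K (s m) (t m)) (kform K (s n) (t n)) < e" .
  qed
qed

lemma klim:
  assumes "Cs s" "Cs t" shows "(\<lambda>n. kform K (s n) (t n)) \<longlonglongrightarrow> klim K s t"
  unfolding klim_def using kform_Cauchy[OF assms]
  by (simp add: Cauchy_convergent_iff convergent_LIMSEQ_iff)

lemma klimI:
  "Cs s \<Longrightarrow> Cs t \<Longrightarrow> (\<lambda>n. kform K (s n) (t n)) \<longlonglongrightarrow> l \<Longrightarrow> klim K s t = l"
  unfolding klim_def by (rule limI)

lemma klim_cong:
  assumes "Rl s s'" "Rl t t'" shows "klim K s t = klim K s' t'"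
proof -
  have C: "Cs s" "Cs s'" "Cs t" "Cs t'" using assms by (auto simp: krel_def)
  obtain b where b: "b > 0" "\<And>n. knorm K (s' n) \<le> b" using Cs_bounded[OF C(2)] by blast
  obtain c where c: "c > 0" "\<And>n. knorm K (t n) \<le> c" using Cs_bounded[OF C(3)] by blast
  have "(\<lambda>n. knorm K (\<lambda>u. s n u - s' n u) * c + b * knorm K (\<lambda>u. t n u - t' n u)) \<longlonglongrightarrow> 0 * c + b * 0"
    using assms by (intro tendsto_intros) (auto simp: krel_def)
  then have L: "(\<lambda>n. knorm K (\<lambda>u. s n u - s' n u) * c + b * knorm K (\<lambda>u. t n u - t' n u)) \<longlonglongrightarrow> 0"
    by simp
  have "(\<lambda>n. kform K (s n) (t n) - kform K (s' n) (t' n)) \<longlonglongrightarrow> 0"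
  proof (rule Lim_null_comparison[OF always_eventually L], intro allI)
    fix n
    have "norm (kform K (s n) (t n) - kform K (s' n) (t' n))
      \<le> knorm K (\<lambda>u. s n u - s' n u) * knorm K (t n) + knorm K (s' n) * knorm K (\<lambda>u. t n u - t' n u)"
      by (intro kform_diff_bound CsD C)
    also have "\<dots> \<le> knorm K (\<lambda>u. s n u - s' n u) * c + b * knorm K (\<lambda>u. t n u - t' n u)"
      using b c by (intro add_mono mult_mono) (auto intro!: knorm_nonneg fs_diff simp: CsD C)
    finally show "norm (kform K (s n) (t n) - kform K (s' n) (t' n))
      \<le> knorm K (\<lambda>u. s n u - s' n u) * c + b * knorm K (\<lambda>u. t n u - t' n u)" .
  qed
  moreover have "(\<lambda>n. kform K (s n) (t n) - kform K (s' n) (t' n)) \<longlonglongrightarrow> klim K s t - klim K s' t'"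
    by (intro tendsto_diff klim C)
  ultimately have "klim K s t - klim K s' t' = 0" using LIMSEQ_unique by blast
  then show ?thesis by simp
qed

lemma klim_add_right:
  assumes "Cs r" "Cs s" "Cs t"
  shows "klim K r (\<lambda>n u. s n u + t n u) = klim K r s + klim K r t"
  using assms by (intro klimI Cs_add) (auto simp: kform_add_right CsD intro!: tendsto_intros klim)

lemma klim_scale_right:
  assumes "Cs r" "Cs s" shows "klim K r (\<lambda>n u. c * s n u) = c * klim K r s"
  using assms by (intro klimI Cs_scale) (auto simp: kform_scale_right CsD intro!: tendsto_intros klim)

lemma klim_herm:
  assumes "Cs r" "Cs s" shows "klim K r s = cnj (klim K s r)"
proof (rule klimI[OF assms])
  have "(\<lambda>n. kform K (r n) (s n)) = (\<lambda>n. cnj (kform K (s n) (r n)))"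
    using assms by (intro ext kform_herm CsD)
  then show "(\<lambda>n. kform K (r n) (s n)) \<longlonglongrightarrow> cnj (klim K s r)"
    using klim[OF assms(2,1)] by (simp add: lim_cnj)
qed

lemma klim_nonneg:
  assumes "Cs s" shows "0 \<le> Re (klim K s s)"
  using tendsto_Re[OF klim[OF assms assms]] psd[OF CsD[OF assms]]
  by (intro LIMSEQ_le_const) auto

lemma Rl_zero_iff:
  assumes "Cs s" shows "Rl s (\<lambda>n u. 0) \<longleftrightarrow> Re (klim K s s) = 0"
proof -
  have L: "(\<lambda>n. Re (kform K (s n) (s n))) \<longlonglongrightarrow> Re (klim K s s)"
    using klim[OF assms assms] by (rule tendsto_Re)
  have N: "(\<lambda>n. knorm K (s n)) \<longlonglongrightarrow> sqrt (Re (klim K s s))"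
    unfolding knorm_def using L by (rule tendsto_real_sqrt)
  have "Rl s (\<lambda>n u. 0) \<longleftrightarrow> (\<lambda>n. knorm K (s n)) \<longlonglongrightarrow> 0"
    using assms by (simp add: krel_def Cs_const[OF fs_zero])
  also have "\<dots> \<longleftrightarrow> sqrt (Re (klim K s s)) = 0"
    using N LIMSEQ_unique[OF N] by metis
  finally show ?thesis by simp
qed

lemma Cs_tail:
  assumes s: "Cs s" and e: "e > 0"
  shows "\<exists>N. \<forall>M\<ge>N. sqrt (Re (klim K (\<lambda>n u. s n u + -1 * s M u) (\<lambda>n u. s n u + -1 * s M u))) < e"
proof -
  have "e / 2 > 0" using e by simp
  then obtain N where N: "\<And>m n. m \<ge> N \<Longrightarrow> n \<ge> N \<Longrightarrow> knorm K (\<lambda>u. s m u - s n u) < e / 2"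
    using s unfolding kCauchy_def by blast
  have "sqrt (Re (klim K (\<lambda>n u. s n u + -1 * s M u) (\<lambda>n u. s n u + -1 * s M u))) < e"
    if M: "M \<ge> N" for M
  proof -
    let ?d = "\<lambda>n u. s n u + -1 * s M u"
    have d: "Cs ?d" using Cs_add[OF s Cs_scale[OF Cs_const[OF CsD[OF s]]], of "-1" M] by simp
    have "(\<lambda>n. knorm K (?d n)) \<longlonglongrightarrow> sqrt (Re (klim K ?d ?d))"
      unfolding knorm_def by (intro tendsto_real_sqrt tendsto_Re klim d)
    then have "sqrt (Re (klim K ?d ?d)) \<le> e / 2"
      by (rule LIMSEQ_le_const2) (use N M in \<open>auto intro!: exI[of _ N] less_imp_le\<close>)
    then show ?thesis using e by linarith
  qed
  then show ?thesis by blast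
qed

lemma klim_const:
  assumes "f \<in> finsupp X" "g \<in> finsupp X"
  shows "klim K (\<lambda>_. f) (\<lambda>_. g) = kform K f g"
  by (intro klimI Cs_const assms tendsto_const)

end

section \<open>The full Fock space\<close>

text \<open>
  Square integrable functions on the half-line. Only the values on \<open>{0..}\<close> matter, and functions
  agreeing almost everywhere there will be identified, being at distance \<open>0\<close> in the Fock space.
\<close>

definition halfline :: "real measure" where
  "halfline = restrict_space lborel {0..}"

definition L2 :: "(real \<Rightarrow> 'b::real_normed_vector) set" where
  "L2 = {f \<in> borel_measurable halfline. integrable halfline (\<lambda>x. (norm (f x))\<^sup>2)}"

text \<open>The complexification of a real Hilbert space \<open>'k\<close> is \<open>'k \<times> 'k\<close>, \<open>(a, b)\<close> standing for \<open>a + \<i> b\<close>.\<close>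

definition cplx_inner :: "'k::real_inner \<times> 'k \<Rightarrow> 'k \<times> 'k \<Rightarrow> complex" where
  "cplx_inner v w = Complex (fst v \<bullet> fst w + snd v \<bullet> snd w) (fst v \<bullet> snd w - snd v \<bullet> fst w)"

definition L2_inner :: "(real \<Rightarrow> 'k::real_inner \<times> 'k) \<Rightarrow> (real \<Rightarrow> 'k \<times> 'k) \<Rightarrow> complex" where
  "L2_inner f g = (\<integral>x. cplx_inner (f x) (g x) \<partial>halfline)"

text \<open>
  A word \<open>[f\<^sub>1, \<dots>, f\<^sub>m]\<close> represents the elementary tensor of \<open>f\<^sub>1, \<dots>, f\<^sub>m\<close>, and the empty word the
  vacuum. As in the usual definition of Hilbert space tensor products, the full Fock
  space is the separated completion of the span of the words for the inner product below.
\<close>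

definition fock_words :: "(real \<Rightarrow> 'k::real_inner \<times> 'k) list set" where
  "fock_words = lists L2"

definition fock_kernel ::
    "(real \<Rightarrow> 'k::real_inner \<times> 'k) list \<Rightarrow> (real \<Rightarrow> 'k \<times> 'k) list \<Rightarrow> complex" where
  "fock_kernel u v = (if length u = length v then \<Prod>i<length u. L2_inner (u ! i) (v ! i) else 0)"

subsection \<open>Positivity of the inner product on words\<close>

definition psd_on :: "'i set \<Rightarrow> ('i \<Rightarrow> 'i \<Rightarrow> complex) \<Rightarrow> bool" where
  "psd_on I A \<longleftrightarrow> (\<forall>i\<in>I. \<forall>j\<in>I. A i j = cnj (A j i)) \<and>
     (\<forall>c. 0 \<le> Re (\<Sum>i\<in>I. \<Sum>j\<in>I. A i j * cnj (c i) * c j))"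

lemma psd_onD:
  assumes "psd_on I A"
  shows "i \<in> I \<Longrightarrow> j \<in> I \<Longrightarrow> A i j = cnj (A j i)"
    and "0 \<le> Re (\<Sum>i\<in>I. \<Sum>j\<in>I. A i j * cnj (c i) * c j)"
  using assms unfolding psd_on_def by blast+

lemma psd_on_subset:
  assumes "psd_on I A" "finite I" "J \<subseteq> I" shows "psd_on J A"
  unfolding psd_on_def
proof (intro conjI ballI allI)
  show "A i j = cnj (A j i)" if "i \<in> J" "j \<in> J" for i j
    using that assms by (intro psd_onD(1)[OF assms(1)]) auto
  fix c :: "'a \<Rightarrow> complex"
  let ?d = "\<lambda>i. if i \<in> J then c i else 0"
  have "(\<Sum>i\<in>I. \<Sum>j\<in>I. A i j * cnj (?d i) * ?d j) = (\<Sum>i\<in>J. \<Sum>j\<in>I. A i j * cnj (?d i) * ?d j)"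
    using assms by (intro sum.mono_neutral_right) auto
  also have "\<dots> = (\<Sum>i\<in>J. \<Sum>j\<in>J. A i j * cnj (?d i) * ?d j)"
    using assms by (intro sum.cong sum.mono_neutral_right) auto
  also have "\<dots> = (\<Sum>i\<in>J. \<Sum>j\<in>J. A i j * cnj (c i) * c j)"
    by (intro sum.cong) auto
  finally show "0 \<le> Re (\<Sum>i\<in>J. \<Sum>j\<in>J. A i j * cnj (c i) * c j)"
    using psd_onD(2)[OF assms(1), of ?d] by simp
qed

lemma psd_on_gram:
  assumes "finite I" "psd_on I A"
  shows "\<exists>(m::nat) a. \<forall>i\<in>I. \<forall>j\<in>I. A i j = (\<Sum>k<m. cnj (a k i) * a k j)"
  using assms
proof (induction I arbitrary: A rule: finite_induct)
  case empty
  then show ?case by auto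
next
  case (insert x I)
  note fin = \<open>finite I\<close> and x = \<open>x \<notin> I\<close> and A = \<open>psd_on (insert x I) A\<close>
  define p where "p = Re (A x x)"
  have Axx: "A x x = of_real p"
    using psd_onD(1)[OF A, of x x] by (simp add: p_def complex_eq_iff)
  have herm: "A i j = cnj (A j i)" if "i \<in> insert x I" "j \<in> insert x I" for i j
    using psd_onD(1)[OF A that] .
  have p0: "p \<ge> 0"
    using psd_onD(2)[OF psd_on_subset[OF A], of "{x}" "\<lambda>_. 1"] fin by (simp add: p_def)
  have p_zero: "A x j = 0" if "p = 0" "j \<in> I" for j
  proof (rule ccontr)
    assume ne: "A x j \<noteq> 0"
    have xj: "x \<noteq> j" using that x by auto
    have key: "2 * s * (cmod (A x j))\<^sup>2 \<le> Re (A j j)" for s :: real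
    proof -
      let ?c = "\<lambda>i. if i = x then - of_real s * A x j else 1"
      have "0 \<le> Re (\<Sum>i\<in>{x, j}. \<Sum>k\<in>{x, j}. A i k * cnj (?c i) * ?c k)"
        using that fin by (intro psd_onD(2)[OF psd_on_subset[OF A]]) auto
      also have "(\<Sum>i\<in>{x, j}. \<Sum>k\<in>{x, j}. A i k * cnj (?c i) * ?c k)
          = - (of_real s * (A x j * cnj (A x j))) - of_real s * (A x j * A j x) + A j j"
        using xj that(1) by (simp add: Axx algebra_simps)
      also have "A j x = cnj (A x j)" using herm[of j x] that by simp
      also have "A x j * cnj (A x j) = of_real ((cmod (A x j))\<^sup>2)"
        by (rule complex_norm_square[symmetric])
      finally show ?thesis by (simp del: of_real_power)
    qed
    have "(cmod (A x j))\<^sup>2 > 0" using ne by simp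
    then show False
      using key[of "(Re (A j j) + 1) / (2 * (cmod (A x j))\<^sup>2)"] by (simp add: field_simps)
  qed
  define A' where "A' i j = A i j - A i x * A x j / of_real p" for i j
  have A': "psd_on I A'"
    unfolding psd_on_def
  proof (intro conjI ballI allI)
    show "A' i j = cnj (A' j i)" if "i \<in> I" "j \<in> I" for i j
      using herm[of i j] herm[of i x] herm[of x j] that by (simp add: A'_def)
    fix c :: "'a \<Rightarrow> complex"
    define F where "F = (\<Sum>i\<in>I. \<Sum>j\<in>I. A i j * cnj (c i) * c j)"
    define S where "S = (\<Sum>j\<in>I. A x j * c j)"
    have cS: "cnj S = (\<Sum>i\<in>I. A i x * cnj (c i))"
      unfolding S_def cnj_sum
    proof (rule sum.cong)
      show "cnj (A x i * c i) = A i x * cnj (c i)" if "i \<in> I" for i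
        using herm[of i x] that by simp
    qed simp
    have "(\<Sum>i\<in>I. \<Sum>j\<in>I. A' i j * cnj (c i) * c j)
        = F - (\<Sum>i\<in>I. \<Sum>j\<in>I. (A i x * cnj (c i)) * (A x j * c j) / of_real p)"
      by (simp add: F_def A'_def sum_subtractf[symmetric] algebra_simps)
    also have "(\<Sum>i\<in>I. \<Sum>j\<in>I. (A i x * cnj (c i)) * (A x j * c j) / of_real p) = cnj S * S / of_real p"
      unfolding cS unfolding S_def sum_product sum_divide_distrib ..
    finally have E: "(\<Sum>i\<in>I. \<Sum>j\<in>I. A' i j * cnj (c i) * c j) = F - cnj S * S / of_real p" .
    show "0 \<le> Re (\<Sum>i\<in>I. \<Sum>j\<in>I. A' i j * cnj (c i) * c j)"
    proof (cases "p = 0")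
      case True
      then show ?thesis
        using E psd_onD(2)[OF psd_on_subset[OF A, of I], of c] fin by (auto simp: F_def)
    next
      case False
      let ?d = "c(x := - S / of_real p)"
      have d: "?d i = c i" if "i \<in> I" for i using that x by auto
      have "(\<Sum>i\<in>insert x I. \<Sum>j\<in>insert x I. A i j * cnj (?d i) * ?d j)
          = (A x x * cnj (?d x) * ?d x + (\<Sum>j\<in>I. A x j * cnj (?d x) * c j))
            + (\<Sum>i\<in>I. A i x * cnj (c i) * ?d x + (\<Sum>j\<in>I. A i j * cnj (c i) * c j))"
      proof -
        have "(\<Sum>j\<in>insert x I. A i j * cnj e * ?d j) = A i x * cnj e * ?d x + (\<Sum>j\<in>I. A i j * cnj e * c j)"
          for i e
        proof -
          have "(\<Sum>j\<in>I. A i j * cnj e * ?d j) = (\<Sum>j\<in>I. A i j * cnj e * c j)"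
            by (rule sum.cong) (simp_all only: d)
          then show ?thesis by (simp only: sum.insert[OF fin x])
        qed
        note E = this
        have "(\<Sum>i\<in>I. A i x * cnj (?d i) * ?d x + (\<Sum>j\<in>I. A i j * cnj (?d i) * c j))
            = (\<Sum>i\<in>I. A i x * cnj (c i) * ?d x + (\<Sum>j\<in>I. A i j * cnj (c i) * c j))"
          by (rule sum.cong) (simp_all only: d)
        then show ?thesis unfolding E sum.insert[OF fin x] by (simp only:)
      qed
      also have "\<dots> = A x x * cnj (?d x) * ?d x + cnj (?d x) * S + cnj S * ?d x + F"
      proof -
        have "(\<Sum>j\<in>I. A x j * cnj (?d x) * c j) = cnj (?d x) * S"
          unfolding S_def sum_distrib_left by (intro sum.cong) (auto simp: mult_ac)
        moreover have "(\<Sum>i\<in>I. A i x * cnj (c i) * ?d x) = cnj S * ?d x"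
          unfolding cS sum_distrib_right by simp
        ultimately show ?thesis by (simp only: sum.distrib F_def add.assoc)
      qed
      also have "\<dots> = F - cnj S * S / of_real p"
        using False by (simp add: Axx field_simps)
      finally show ?thesis
        using psd_onD(2)[OF A, of ?d] E by simp
    qed
  qed
  obtain m a where a: "\<And>i j. i \<in> I \<Longrightarrow> j \<in> I \<Longrightarrow> A' i j = (\<Sum>k<m::nat. cnj (a k i) * a k j)"
    using insert.IH[OF A'] by blast
  define b where "b k i = (if k = m then A x i / of_real (sqrt p) else if i = x then 0 else a k i)" for k i
  have sq: "complex_of_real (sqrt p) * complex_of_real (sqrt p) = of_real p"
    using p0 by (simp flip: of_real_mult)
  have bm: "cnj (b m i) * b m j = A i x * A x j / of_real p" if "i \<in> insert x I" for i j
    using herm[of i x] that by (simp add: b_def sq)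
  have "A i j = (\<Sum>k<Suc m. cnj (b k i) * b k j)" if ij: "i \<in> insert x I" "j \<in> insert x I" for i j
  proof -
    have "(\<Sum>k<Suc m. cnj (b k i) * b k j) = (\<Sum>k<m. cnj (b k i) * b k j) + A i x * A x j / of_real p"
      using bm[OF ij(1)] by simp
    also have "\<dots> = A i j"
    proof (cases "i = x \<or> j = x")
      case True
      then have z: "(\<Sum>k<m. cnj (b k i) * b k j) = 0" by (auto simp: b_def)
      show ?thesis
      proof (cases "p = 0")
        case True
        have "A x y = 0" "A y x = 0" if "y \<in> insert x I" for y
          using that p_zero[OF True] herm[of y x] Axx True by auto
        then show ?thesis using \<open>i = x \<or> j = x\<close> ij z by auto
      next
        case False
        then show ?thesis using \<open>i = x \<or> j = x\<close> z by (auto simp: Axx)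
      qed
    next
      case False
      then have I: "i \<in> I" "j \<in> I" using ij by auto
      then have "(\<Sum>k<m. cnj (b k i) * b k j) = A' i j"
        using x by (subst a) (auto simp: b_def intro!: sum.cong)
      then show ?thesis by (simp add: A'_def)
    qed
    finally show ?thesis by simp
  qed
  then show ?case by blast
qed

lemma psd_on_mult:
  assumes fin: "finite I" and A: "psd_on I A" and B: "psd_on I B"
  shows "psd_on I (\<lambda>i j. A i j * B i j)"
  unfolding psd_on_def
proof (intro conjI ballI allI)
  show "A i j * B i j = cnj (A j i * B j i)" if "i \<in> I" "j \<in> I" for i j
    using psd_onD(1)[OF A that] psd_onD(1)[OF B that] by simp
  fix c :: "'a \<Rightarrow> complex"
  obtain m a where a: "\<And>i j. i \<in> I \<Longrightarrow> j \<in> I \<Longrightarrow> A i j = (\<Sum>k<m::nat. cnj (a k i) * a k j)"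
    using psd_on_gram[OF fin A] by blast
  have "(\<Sum>i\<in>I. \<Sum>j\<in>I. A i j * B i j * cnj (c i) * c j)
      = (\<Sum>i\<in>I. \<Sum>j\<in>I. \<Sum>k<m. B i j * cnj (a k i * c i) * (a k j * c j))"
    by (intro sum.cong refl) (simp add: a sum_distrib_left sum_distrib_right mult_ac)
  also have "\<dots> = (\<Sum>i\<in>I. \<Sum>k<m. \<Sum>j\<in>I. B i j * cnj (a k i * c i) * (a k j * c j))"
    by (intro sum.cong refl sum.swap)
  also have "\<dots> = (\<Sum>k<m. \<Sum>i\<in>I. \<Sum>j\<in>I. B i j * cnj (a k i * c i) * (a k j * c j))"
    by (rule sum.swap)
  also have "Re \<dots> \<ge> 0"
    unfolding Re_sum[of _ "{..<m}"] by (intro sum_nonneg psd_onD(2)[OF B])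
  finally show "0 \<le> Re (\<Sum>i\<in>I. \<Sum>j\<in>I. A i j * B i j * cnj (c i) * c j)" .
qed

lemma psd_on_one: "psd_on I (\<lambda>i j. 1)"
proof -
  have "0 \<le> Re (\<Sum>i\<in>I. \<Sum>j\<in>I. 1 * cnj (c i) * c j)" for c :: "'a \<Rightarrow> complex"
  proof -
    have "(\<Sum>i\<in>I. \<Sum>j\<in>I. 1 * cnj (c i) * c j) = cnj (\<Sum>j\<in>I. c j) * (\<Sum>j\<in>I. c j)"
      by (simp add: sum_product)
    also have "\<dots> = (\<Sum>j\<in>I. c j) * cnj (\<Sum>j\<in>I. c j)" by (rule mult.commute)
    also have "\<dots> = of_real ((cmod (\<Sum>j\<in>I. c j))\<^sup>2)"
      by (rule complex_norm_square[symmetric])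
    finally show ?thesis by (simp del: of_real_power)
  qed
  then show ?thesis by (simp add: psd_on_def)
qed

lemma psd_on_prod:
  assumes fin: "finite I" and A: "\<And>k. k < n \<Longrightarrow> psd_on I (A k)"
  shows "psd_on I (\<lambda>i j. \<Prod>k<n::nat. A k i j)"
  using A
proof (induction n)
  case 0
  then show ?case by (simp add: psd_on_one)
next
  case (Suc n)
  then show ?case using psd_on_mult[OF fin] by simp
qed

lemma cplx_inner_herm: "cplx_inner v w = cnj (cplx_inner w v)"
  by (simp add: cplx_inner_def complex_eq_iff inner_commute)

lemma psd_on_cplx_inner:
  "psd_on I (\<lambda>i j. cplx_inner (v i) (v j))"
proof -
  have H: "0 \<le> Re (\<Sum>i\<in>I. \<Sum>j\<in>I. cplx_inner (v i) (v j) * cnj (c i) * c j)" for c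
  proof -
    define a where "a i = Re (c i) *\<^sub>R fst (v i) - Im (c i) *\<^sub>R snd (v i)" for i
    define b where "b i = Re (c i) *\<^sub>R snd (v i) + Im (c i) *\<^sub>R fst (v i)" for i
    have "Re (cplx_inner (v i) (v j) * cnj (c i) * c j) = a i \<bullet> a j + b i \<bullet> b j" for i j
      by (simp add: cplx_inner_def a_def b_def inner_add_left inner_add_right inner_diff_left
          inner_diff_right algebra_simps)
    then have "Re (\<Sum>i\<in>I. \<Sum>j\<in>I. cplx_inner (v i) (v j) * cnj (c i) * c j)
        = (\<Sum>i\<in>I. \<Sum>j\<in>I. a i \<bullet> a j) + (\<Sum>i\<in>I. \<Sum>j\<in>I. b i \<bullet> b j)"
      by (simp only: Re_sum sum.distrib)
    also have "\<dots> = (\<Sum>i\<in>I. a i) \<bullet> (\<Sum>i\<in>I. a i) + (\<Sum>i\<in>I. b i) \<bullet> (\<Sum>i\<in>I. b i)"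
      by (simp only: inner_sum_left, simp only: inner_sum_right)
    finally have "Re (\<Sum>i\<in>I. \<Sum>j\<in>I. cplx_inner (v i) (v j) * cnj (c i) * c j) = \<dots>" .
    then show ?thesis by simp
  qed
  have h: "\<forall>i\<in>I. \<forall>j\<in>I. cplx_inner (v i) (v j) = cnj (cplx_inner (v j) (v i))"
    by (rule ballI, rule ballI, rule cplx_inner_herm)
  show ?thesis unfolding psd_on_def
  proof (rule conjI)
    show "\<forall>i\<in>I. \<forall>j\<in>I. cplx_inner (v i) (v j) = cnj (cplx_inner (v j) (v i))"
      by (fact h)
    show "\<forall>c. 0 \<le> Re (\<Sum>i\<in>I. \<Sum>j\<in>I. cplx_inner (v i) (v j) * cnj (c i) * c j)"
      by (rule allI, rule H)
  qed
qed

lemma norm_cplx_inner_le: "cmod (cplx_inner v w) \<le> 2 * ((norm v)\<^sup>2 + (norm w)\<^sup>2)"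
proof -
  have n: "(norm v)\<^sup>2 = (norm (fst v))\<^sup>2 + (norm (snd v))\<^sup>2" for v :: "'a \<times> 'a"
    by (simp add: norm_prod_def)
  have q: "2 * \<bar>x \<bullet> y\<bar> \<le> (norm x)\<^sup>2 + (norm y)\<^sup>2" for x y :: 'a
    proof -
    have "2 * \<bar>x \<bullet> y\<bar> \<le> 2 * (norm x * norm y)"
      using Cauchy_Schwarz_ineq2[of x y] by simp
    also have "\<dots> \<le> (norm x)\<^sup>2 + (norm y)\<^sup>2"
      using sum_squares_bound[of "norm x" "norm y"] by (simp only: mult.assoc)
    finally show ?thesis .
  qed
  have "cmod (cplx_inner v w) \<le> \<bar>fst v \<bullet> fst w + snd v \<bullet> snd w\<bar> + \<bar>fst v \<bullet> snd w - snd v \<bullet> fst w\<bar>"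
    using cmod_le[of "cplx_inner v w"] by (simp add: cplx_inner_def)
  also have "\<dots> \<le> \<bar>fst v \<bullet> fst w\<bar> + \<bar>snd v \<bullet> snd w\<bar> + \<bar>fst v \<bullet> snd w\<bar> + \<bar>snd v \<bullet> fst w\<bar>"
    by linarith
  also have "\<dots> \<le> 2 * ((norm v)\<^sup>2 + (norm w)\<^sup>2)"
  proof -
    have gen: "A + B + C + D \<le> 2 * (V + W)"
      if "2 * A \<le> v1 + w1" "2 * B \<le> v2 + w2" "2 * C \<le> v1 + w2" "2 * D \<le> v2 + w1"
        "0 \<le> V" "0 \<le> W" "V = v1 + v2" "W = w1 + w2" for A B C D V W v1 v2 w1 w2 :: real
    proof -
      have "2 * (A + B + C + D) \<le> (v1 + w1) + (v2 + w2) + (v1 + w2) + (v2 + w1)"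
        using add_mono[OF add_mono[OF add_mono[OF that(1) that(2)] that(3)] that(4)]
        by (simp only: distrib_left)
      also have "\<dots> = 2 * (V + W)" unfolding that(7,8) by simp
      finally show ?thesis using that(5,6) by simp
    qed
    show ?thesis
      using gen[OF q[of "fst v" "fst w"] q[of "snd v" "snd w"] q[of "fst v" "snd w"]
        q[of "snd v" "fst w"] zero_le_power2 zero_le_power2 n[of v] n[of w]] .
  qed
  finally show ?thesis .
qed

lemma integrable_cplx_inner:
  fixes f g :: "real \<Rightarrow> 'k::{real_inner,second_countable_topology} \<times> 'k"
  assumes "f \<in> L2" "g \<in> L2"
  shows "integrable halfline (\<lambda>x. cplx_inner (f x) (g x))"
proof (rule Bochner_Integration.integrable_bound)
  have m: "f \<in> borel_measurable halfline" "g \<in> borel_measurable halfline"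
    using assms by (auto simp: L2_def)
  have c: "(\<lambda>x. fst (h x)) \<in> borel_measurable halfline" "(\<lambda>x. snd (h x)) \<in> borel_measurable halfline"
    if "h \<in> borel_measurable halfline" for h :: "real \<Rightarrow> 'k \<times> 'k"
    using that by (auto intro: borel_measurable_continuous_on[OF continuous_on_fst[OF continuous_on_id]]
        borel_measurable_continuous_on[OF continuous_on_snd[OF continuous_on_id]])
  show "(\<lambda>x. cplx_inner (f x) (g x)) \<in> borel_measurable halfline"
    unfolding cplx_inner_def Complex_eq
    using c[OF m(1)] c[OF m(2)] by measurable
  show "integrable halfline (\<lambda>x. 2 * ((norm (f x))\<^sup>2 + (norm (g x))\<^sup>2))"
    using assms by (auto simp: L2_def)
  show "AE x in halfline. norm (cplx_inner (f x) (g x)) \<le> norm (2 * ((norm (f x))\<^sup>2 + (norm (g x))\<^sup>2))"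
    unfolding real_norm_def
    by (intro always_eventually allI order_trans[OF norm_cplx_inner_le abs_ge_self])
qed

lemma psd_on_L2_inner:
  fixes F :: "'i \<Rightarrow> real \<Rightarrow> 'k::{real_inner,second_countable_topology} \<times> 'k"
  assumes F: "\<And>i. i \<in> I \<Longrightarrow> F i \<in> L2"
  shows "psd_on I (\<lambda>i j. L2_inner (F i) (F j))"
  unfolding psd_on_def
proof (intro conjI ballI allI)
  show "L2_inner (F i) (F j) = cnj (L2_inner (F j) (F i))" for i j
    unfolding L2_inner_def by (subst cplx_inner_herm) simp
  fix c :: "'i \<Rightarrow> complex"
  have int: "integrable halfline (\<lambda>x. cplx_inner (F i x) (F j x) * cnj (c i) * c j)"
    if "i \<in> I" "j \<in> I" for i j
    using integrable_cplx_inner[OF F F] that by auto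
  let ?h = "\<lambda>i j x. cplx_inner (F i x) (F j x) * cnj (c i) * c j"
  have int_row: "integrable halfline (\<lambda>x. \<Sum>j\<in>I. ?h i j x)" if "i \<in> I" for i
    using int that by (intro Bochner_Integration.integrable_sum)
  have "L2_inner (F i) (F j) * cnj (c i) * c j = (\<integral>x. ?h i j x \<partial>halfline)" for i j
    unfolding L2_inner_def by (simp only: integral_mult_left_zero)
  then have "(\<Sum>i\<in>I. \<Sum>j\<in>I. L2_inner (F i) (F j) * cnj (c i) * c j)
      = (\<Sum>i\<in>I. \<Sum>j\<in>I. \<integral>x. ?h i j x \<partial>halfline)"
    by (simp only:)
  also have "\<dots> = (\<Sum>i\<in>I. \<integral>x. (\<Sum>j\<in>I. ?h i j x) \<partial>halfline)"
    by (intro sum.cong refl Bochner_Integration.integral_sum[symmetric] int)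
  also have "\<dots> = (\<integral>x. (\<Sum>i\<in>I. \<Sum>j\<in>I. ?h i j x) \<partial>halfline)"
    by (intro Bochner_Integration.integral_sum[symmetric] int_row)
  finally have "Re (\<Sum>i\<in>I. \<Sum>j\<in>I. L2_inner (F i) (F j) * cnj (c i) * c j)
      = Re (\<integral>x. (\<Sum>i\<in>I. \<Sum>j\<in>I. ?h i j x) \<partial>halfline)"
    by (simp only:)
  also have "\<dots> = (\<integral>x. Re (\<Sum>i\<in>I. \<Sum>j\<in>I. ?h i j x) \<partial>halfline)"
    by (intro integral_Re[symmetric] Bochner_Integration.integrable_sum int_row)
  also have "\<dots> \<ge> 0"
    using psd_onD(2)[OF psd_on_cplx_inner] by (intro integral_nonneg_AE always_eventually allI)
  finally show "0 \<le> Re (\<Sum>i\<in>I. \<Sum>j\<in>I. L2_inner (F i) (F j) * cnj (c i) * c j)" .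
qed

lemma psd_on_fock_kernel:
  fixes W :: "(real \<Rightarrow> 'k::{real_inner,second_countable_topology} \<times> 'k) list set"
  assumes fin: "finite W" and W: "W \<subseteq> fock_words"
  shows "psd_on W fock_kernel"
  unfolding psd_on_def
proof (intro conjI ballI allI)
  show "fock_kernel u v = cnj (fock_kernel v u)" for u v :: "(real \<Rightarrow> 'k \<times> 'k) list"
  proof -
    have "L2_inner f g = cnj (L2_inner g f)" for f g :: "real \<Rightarrow> 'k \<times> 'k"
      unfolding L2_inner_def by (subst cplx_inner_herm) simp
    note L = this
    show ?thesis
    proof (cases "length u = length v")
      case True
      have "(\<Prod>i<length u. L2_inner (u ! i) (v ! i)) = (\<Prod>i<length u. cnj (L2_inner (v ! i) (u ! i)))"
        by (rule prod.cong[OF refl], rule L)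
      then show ?thesis using True by (simp add: fock_kernel_def)
    qed (simp add: fock_kernel_def)
  qed
  fix c :: "(real \<Rightarrow> 'k \<times> 'k) list \<Rightarrow> complex"
  let ?W = "\<lambda>m. {w \<in> W. length w = m}"
  have split: "sum h W = (\<Sum>m\<in>length ` W. sum h (?W m))" for h :: "_ \<Rightarrow> complex"
    using fin by (intro sum.group[symmetric]) auto
  have "(\<Sum>u\<in>W. \<Sum>v\<in>W. fock_kernel u v * cnj (c u) * c v)
      = (\<Sum>m\<in>length ` W. \<Sum>u\<in>?W m. \<Sum>v\<in>W. fock_kernel u v * cnj (c u) * c v)"
    by (rule split)
  also have "\<dots> = (\<Sum>m\<in>length ` W. \<Sum>u\<in>?W m. \<Sum>v\<in>?W m. (\<Prod>i<m. L2_inner (u ! i) (v ! i)) * cnj (c u) * c v)"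
  proof (rule sum.cong[OF refl], rule sum.cong[OF refl])
    fix m u assume "u \<in> ?W m"
    then have l: "length u = m" by simp
    have "(\<Sum>v\<in>W. fock_kernel u v * cnj (c u) * c v) = (\<Sum>v\<in>?W m. fock_kernel u v * cnj (c u) * c v)"
      using fin l by (intro sum.mono_neutral_right) (auto simp: fock_kernel_def)
    also have "\<dots> = (\<Sum>v\<in>?W m. (\<Prod>i<m. L2_inner (u ! i) (v ! i)) * cnj (c u) * c v)"
      using l by (intro sum.cong) (auto simp: fock_kernel_def)
    finally show "(\<Sum>v\<in>W. fock_kernel u v * cnj (c u) * c v)
      = (\<Sum>v\<in>?W m. (\<Prod>i<m. L2_inner (u ! i) (v ! i)) * cnj (c u) * c v)" .
  qed
  also have "Re \<dots> \<ge> 0"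
    unfolding Re_sum[of _ "length ` W"]
  proof (intro sum_nonneg)
    fix m
    have "psd_on (?W m) (\<lambda>u v. \<Prod>i<m. L2_inner (u ! i) (v ! i))"
      using fin W by (intro psd_on_prod psd_on_L2_inner) (auto simp: fock_words_def)
    then show "0 \<le> Re (\<Sum>u\<in>?W m. \<Sum>v\<in>?W m. (\<Prod>i<m. L2_inner (u ! i) (v ! i)) * cnj (c u) * c v)"
      by (rule psd_onD(2))
  qed
  finally show "0 \<le> Re (\<Sum>u\<in>W. \<Sum>v\<in>W. fock_kernel u v * cnj (c u) * c v)" .
qed

interpretation fock: psd_kernel
  "fock_words :: (real \<Rightarrow> 'k::{real_inner,second_countable_topology} \<times> 'k) list set" fock_kernel
proof
  show "fock_kernel u v = cnj (fock_kernel v u)"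
    if "u \<in> fock_words" "v \<in> fock_words" for u v :: "(real \<Rightarrow> 'k \<times> 'k) list"
    using psd_onD(1)[OF psd_on_fock_kernel[of "{u, v}"], of u v] that by auto
  show "0 \<le> Re (kform fock_kernel f f)"
    if "f \<in> finsupp fock_words" for f :: "(real \<Rightarrow> 'k \<times> 'k) list \<Rightarrow> complex"
    using psd_onD(2)[OF psd_on_fock_kernel[of "{u. f u \<noteq> 0}"], of f] that
    unfolding kform_def finsupp_def by auto
qed

subsection \<open>The Hilbert space structure\<close>

quotient_type (overloaded) 'k fock =
  "nat \<Rightarrow> (real \<Rightarrow> 'k::{real_inner,polish_space} \<times> 'k) list \<Rightarrow> complex" /
  partial: "krel (finsupp fock_words) fock_kernel"
  by (rule fock.Rl_part_equivp)

lemma krel_iff_eq: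
  fixes s :: "nat \<Rightarrow> (real \<Rightarrow> 'k::{real_inner,second_countable_topology} \<times> 'k) list \<Rightarrow> complex"
  shows "krel (finsupp fock_words) fock_kernel s s \<longleftrightarrow> kCauchy (finsupp fock_words) fock_kernel s"
  by (auto simp: krel_def fock.knorm_zero)

instantiation fock :: ("{real_inner,polish_space}") ab_group_add
begin

lift_definition zero_fock :: "'a fock" is "\<lambda>n u. 0"
  by (intro fock.Rl_refl fock.Cs_const fock.fs_zero)

lift_definition plus_fock :: "'a fock \<Rightarrow> 'a fock \<Rightarrow> 'a fock" is "\<lambda>s t n u. s n u + t n u"
  by (rule fock.Rl_add)

lift_definition uminus_fock :: "'a fock \<Rightarrow> 'a fock" is "\<lambda>s n u. -1 * s n u"
  by (rule fock.Rl_scale)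

definition minus_fock :: "'a fock \<Rightarrow> 'a fock \<Rightarrow> 'a fock" where
  "minus_fock x y = x + - y"

instance
proof
  fix x y z :: "'a fock"
  show "x + y + z = x + (y + z)"
    by transfer (auto simp: krel_iff_eq fock.Cs_add add.assoc intro: fock.Rl_refl)
  show "x + y = y + x"
    by transfer (auto simp: krel_iff_eq fock.Cs_add add.commute intro: fock.Rl_refl)
  show "0 + x = x"
    by transfer auto
  show "- x + x = 0"
    by transfer (simp add: fock.Rl_refl fock.Cs_const fock.fs_zero)
  show "x - y = x + - y" by (simp add: minus_fock_def)
qed

end

instantiation fock :: ("{real_inner,polish_space}") real_vector
begin

lift_definition cscale_fock :: "complex \<Rightarrow> 'a fock \<Rightarrow> 'a fock" is "\<lambda>c s n u. c * s n u"
  by (rule fock.Rl_scale)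

definition scaleR_fock :: "real \<Rightarrow> 'a fock \<Rightarrow> 'a fock" where
  "scaleR_fock r x = cscale_fock (of_real r) x"

lemma cscale_fock_laws:
  fixes x y :: "'a fock"
  shows "cscale_fock c (x + y) = cscale_fock c x + cscale_fock c y"
    and "cscale_fock (c + d) x = cscale_fock c x + cscale_fock d x"
    and "cscale_fock c (cscale_fock d x) = cscale_fock (c * d) x"
    and "cscale_fock 1 x = x"
  by (transfer, auto simp: krel_iff_eq algebra_simps intro!: fock.Rl_refl fock.Cs_add
      fock.Cs_scale[where c = "_ * _", unfolded mult.assoc] fock.Cs_scale)+

instance
  by standard (simp_all add: scaleR_fock_def cscale_fock_laws)

end

instantiation fock :: ("{real_inner,polish_space}") real_inner
begin

lift_definition cip_fock :: "'a fock \<Rightarrow> 'a fock \<Rightarrow> complex" is "klim fock_kernel"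
  by (rule fock.klim_cong)

definition inner_fock :: "'a fock \<Rightarrow> 'a fock \<Rightarrow> real" where
  "inner_fock x y = Re (cip_fock x y)"

definition norm_fock :: "'a fock \<Rightarrow> real" where "norm_fock x = sqrt (inner x x)"
definition sgn_fock :: "'a fock \<Rightarrow> 'a fock" where "sgn_fock x = x /\<^sub>R norm x"
definition dist_fock :: "'a fock \<Rightarrow> 'a fock \<Rightarrow> real" where "dist_fock x y = norm (x - y)"
definition uniformity_fock :: "('a fock \<times> 'a fock) filter" where
  "uniformity_fock = (INF e\<in>{0 <..}. principal {(x, y). dist x y < e})"
definition open_fock :: "'a fock set \<Rightarrow> bool" where
  "open_fock U \<longleftrightarrow> (\<forall>x\<in>U. \<forall>\<^sub>F (x', y) in uniformity. x' = x \<longrightarrow> y \<in> U)"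

lemma cip_fock_laws:
  fixes x y z :: "'a fock"
  shows "cip_fock x y = cnj (cip_fock y x)"
    and "cip_fock x (y + z) = cip_fock x y + cip_fock x z"
    and "cip_fock x (cscale_fock c y) = c * cip_fock x y"
    and "0 \<le> Re (cip_fock x x)"
    and "Re (cip_fock x x) = 0 \<longleftrightarrow> x = 0"
  by (transfer, simp add: krel_iff_eq fock.klim_add_right fock.klim_scale_right fock.klim_nonneg
      fock.Rl_zero_iff fock.klim_herm[symmetric])+

instance
proof
  fix x y z :: "'a fock" and a :: real
  show comm: "x \<bullet> y = y \<bullet> x" for x y :: "'a fock"
    unfolding inner_fock_def by (subst cip_fock_laws(1)) simp
  have "z \<bullet> (x + y) = z \<bullet> x + z \<bullet> y"
    by (simp add: inner_fock_def cip_fock_laws(2))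
  then show "(x + y) \<bullet> z = x \<bullet> z + y \<bullet> z"
    by (simp only: comm[of _ z])
  have "y \<bullet> (a *\<^sub>R x) = a * (y \<bullet> x)"
    by (simp add: inner_fock_def scaleR_fock_def cip_fock_laws(3))
  then show "(a *\<^sub>R x) \<bullet> y = a * (x \<bullet> y)"
    by (simp only: comm[of _ y])
  show "0 \<le> x \<bullet> x" "x \<bullet> x = 0 \<longleftrightarrow> x = 0"
    by (simp_all add: inner_fock_def cip_fock_laws(4,5))
  show "norm x = sqrt (x \<bullet> x)" "sgn x = x /\<^sub>R norm x" "dist x y = norm (x - y)"
    by (simp_all add: norm_fock_def sgn_fock_def dist_fock_def)
  show "(uniformity :: ('a fock \<times> 'a fock) filter) = (INF e\<in>{0 <..}. principal {(x, y). dist x y < e})"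
    by (rule uniformity_fock_def)
  show "open U \<longleftrightarrow> (\<forall>x\<in>U. \<forall>\<^sub>F (x', y) in uniformity. x' = x \<longrightarrow> y \<in> U)" for U :: "'a fock set"
    by (rule open_fock_def)
qed

end

definition of_words :: "((real \<Rightarrow> 'k::{real_inner,polish_space} \<times> 'k) list \<Rightarrow> complex) \<Rightarrow> 'k fock" where
  "of_words f = abs_fock (\<lambda>_. f)"

lemma dist_of_words_tail:
  fixes s :: "nat \<Rightarrow> (real \<Rightarrow> 'k::{real_inner,polish_space} \<times> 'k) list \<Rightarrow> complex"
  assumes s: "kCauchy (finsupp fock_words) fock_kernel s" and e: "e > 0"
  shows "\<exists>N. \<forall>M\<ge>N. dist (abs_fock s) (of_words (s M)) < e"
proof -
  obtain N where N: "\<And>M. M \<ge> N \<Longrightarrow>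
      sqrt (Re (klim fock_kernel (\<lambda>n u. s n u + -1 * s M u) (\<lambda>n u. s n u + -1 * s M u))) < e"
    using fock.Cs_tail[OF s e] by blast
  have "dist (abs_fock s) (of_words (s M)) < e" if M: "M \<ge> N" for M
  proof -
    let ?d = "\<lambda>n u. s n u + -1 * s M u"
    have c: "kCauchy (finsupp fock_words) fock_kernel (\<lambda>_. s M)" using fock.CsD[OF s] by (rule fock.Cs_const)
    have cm: "kCauchy (finsupp fock_words) fock_kernel (\<lambda>_ u. -1 * s M u)" using c by (rule fock.Cs_scale)
    have d: "kCauchy (finsupp fock_words) fock_kernel ?d" using fock.Cs_add[OF s cm] .
    have "abs_fock s - of_words (s M) = abs_fock ?d"
      unfolding minus_fock_def of_words_def
      using uminus_fock.abs_eq[of "\<lambda>_. s M"] plus_fock.abs_eq[of s "\<lambda>_ u. -1 * s M u"] s c cm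
      by (simp only: krel_iff_eq)
    moreover have "cip_fock (abs_fock ?d) (abs_fock ?d) = klim fock_kernel ?d ?d"
      using cip_fock.abs_eq[of ?d ?d] d by (simp only: krel_iff_eq)
    ultimately show ?thesis using N[OF M] by (simp only: dist_norm norm_fock_def inner_fock_def)
  qed
  then show ?thesis by blast
qed

lemma fock_cases:
  fixes x :: "'k::{real_inner,polish_space} fock"
  obtains s where "kCauchy (finsupp fock_words) fock_kernel s" "x = abs_fock s"
proof -
  have "\<exists>s. kCauchy (finsupp fock_words) fock_kernel s \<and> x = abs_fock s"
    by (induct x rule: fock.abs_induct) (auto simp only: krel_iff_eq)
  then show thesis using that by blast
qed

instance fock :: ("{real_inner,polish_space}") complete_space
proof
  fix X :: "nat \<Rightarrow> 'a fock" assume X: "Cauchy X"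
  let ?C = "kCauchy (finsupp fock_words) fock_kernel"
  have "\<exists>f. f \<in> finsupp fock_words \<and> dist (X n) (of_words f) < 1 / Suc n" for n
  proof -
    obtain s where s: "?C s" "X n = abs_fock s"
      by (rule fock_cases)
    have "0 < 1 / real (Suc n)" by simp
    then obtain N where "dist (abs_fock s) (of_words (s N)) < 1 / Suc n"
      using dist_of_words_tail[OF s(1)] by blast
    then show ?thesis
      by (intro exI[of _ "s N"] conjI fock.CsD[OF s(1)]) (simp only: s(2))
  qed
  then obtain f where f: "\<And>n. f n \<in> finsupp fock_words" "\<And>n. dist (X n) (of_words (f n)) < 1 / Suc n"
    by metis
  have knorm: "knorm fock_kernel (\<lambda>u. g u - h u) = dist (of_words g) (of_words h)"
    if "g \<in> finsupp fock_words" "h \<in> finsupp fock_words" for g h :: "(real \<Rightarrow> 'a \<times> 'a) list \<Rightarrow> complex"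
  proof -
    have c: "?C (\<lambda>_. g)" "?C (\<lambda>_. h)" "?C (\<lambda>_ u. -1 * h u)" "?C (\<lambda>_ u. g u + -1 * h u)"
      by (rule fock.Cs_const, intro fock.fs_add fock.fs_scale that)+
    have "of_words g - of_words h = abs_fock (\<lambda>_ u. g u + -1 * h u)"
      unfolding minus_fock_def of_words_def
      using uminus_fock.abs_eq[of "\<lambda>_. h"] plus_fock.abs_eq[of "\<lambda>_. g" "\<lambda>_ u. -1 * h u"] c
      by (simp only: krel_iff_eq)
    moreover have "cip_fock (abs_fock (\<lambda>_ u. g u + -1 * h u)) (abs_fock (\<lambda>_ u. g u + -1 * h u))
        = kform fock_kernel (\<lambda>u. g u + -1 * h u) (\<lambda>u. g u + -1 * h u)"
      using cip_fock.abs_eq[of "\<lambda>_ u. g u + -1 * h u" "\<lambda>_ u. g u + -1 * h u"] c(4) fock.CsD[OF c(4)]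
      by (simp only: krel_iff_eq fock.klim_const)
    moreover have "(\<lambda>u. g u + -1 * h u) = (\<lambda>u. g u - h u)" by auto
    ultimately show ?thesis by (simp only: dist_norm norm_fock_def inner_fock_def knorm_def)
  qed
  have small: "(\<lambda>n. dist (X n) (of_words (f n))) \<longlonglongrightarrow> 0"
    by (rule tendsto_sandwich[OF _ _ tendsto_const LIMSEQ_inverse_real_of_nat])
      (use f in \<open>auto intro!: always_eventually less_imp_le simp: inverse_eq_divide\<close>)
  have diff: "(\<lambda>n. X n - of_words (f n)) \<longlonglongrightarrow> 0"
    using small by (simp add: tendsto_norm_zero_iff dist_norm)
  have Y: "Cauchy (\<lambda>n. of_words (f n))"
  proof (rule metric_CauchyI)
    fix e :: real assume "e > 0"
    then have e: "e / 3 > 0" by simp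
    obtain N1 where N1: "\<And>m n. m \<ge> N1 \<Longrightarrow> n \<ge> N1 \<Longrightarrow> dist (X m) (X n) < e / 3"
      using metric_CauchyD[OF X e] by blast
    obtain N2 where N2: "\<And>n. n \<ge> N2 \<Longrightarrow> dist (X n) (of_words (f n)) < e / 3"
      using metric_LIMSEQ_D[OF small e] by auto
    show "\<exists>M. \<forall>m\<ge>M. \<forall>n\<ge>M. dist (of_words (f m)) (of_words (f n)) < e"
    proof (intro exI[of _ "max N1 N2"] allI impI)
      fix m n assume mn: "max N1 N2 \<le> m" "max N1 N2 \<le> n"
      have "dist (of_words (f m)) (of_words (f n))
          \<le> dist (of_words (f m)) (X m) + (dist (X m) (X n) + dist (X n) (of_words (f n)))"
        using dist_triangle[of "of_words (f m)" "of_words (f n)" "X m"]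
          dist_triangle[of "X m" "of_words (f n)" "X n"] by linarith
      also have "\<dots> < e"
        using N1[of m n] N2[of m] N2[of n] mn by (simp add: dist_commute[of "of_words (f m)"])
      finally show "dist (of_words (f m)) (of_words (f n)) < e" .
    qed
  qed
  have cf: "?C f"
    using f(1) Y unfolding kCauchy_def Cauchy_def by (simp only: knorm[OF f(1) f(1)] simp_thms)
  have "(\<lambda>n. of_words (f n)) \<longlonglongrightarrow> abs_fock f"
    using dist_of_words_tail[OF cf] by (intro metric_LIMSEQ_I) (simp add: dist_commute)
  then have "X \<longlonglongrightarrow> abs_fock f"
    using tendsto_add[OF diff, of "\<lambda>n. of_words (f n)" "abs_fock f"] by simp
  then show "convergent X" by (auto simp: convergent_def)
qed

instantiation fock :: ("{real_inner,polish_space}") chilbert_space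
begin

definition scaleC_fock :: "complex \<Rightarrow> 'a fock \<Rightarrow> 'a fock" where "scaleC_fock = cscale_fock"

definition cinner_fock :: "'a fock \<Rightarrow> 'a fock \<Rightarrow> complex" where "cinner_fock = cip_fock"

instance
proof
  fix x y :: "'a fock"
  show "cinner x y = cnj (cinner y x)"
    unfolding cinner_fock_def by (rule cip_fock_laws(1))
qed (simp_all add: scaleC_fock_def cinner_fock_def cscale_fock_laws cip_fock_laws(2,3) scaleR_fock_def
    inner_fock_def)

end

definition tensor :: "(real \<Rightarrow> 'k::{real_inner,polish_space} \<times> 'k) list \<Rightarrow> 'k fock" where
  "tensor w = of_words (\<lambda>u. if u = w then 1 else 0)"

definition vacuum :: "'k::{real_inner,polish_space} fock" (\<open>\<Omega>\<close>) where
  "vacuum = tensor []"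

lemma cinner_of_words:
  fixes f g :: "(real \<Rightarrow> 'k::{real_inner,polish_space} \<times> 'k) list \<Rightarrow> complex"
  assumes "f \<in> finsupp fock_words" "g \<in> finsupp fock_words"
  shows "cinner (of_words f) (of_words g) = kform fock_kernel f g"
  using cip_fock.abs_eq[of "\<lambda>_. f" "\<lambda>_. g"] assms
  by (simp add: cinner_fock_def of_words_def krel_iff_eq fock.Cs_const fock.klim_const)

lemma cinner_tensor:
  fixes u v :: "(real \<Rightarrow> 'k::{real_inner,polish_space} \<times> 'k) list"
  assumes "u \<in> fock_words" "v \<in> fock_words"
  shows "cinner (tensor u) (tensor v) = fock_kernel u v"
proof -
  have "(\<lambda>w. if w = x then 1 else 0) \<in> finsupp fock_words" if "x \<in> fock_words"
    for x :: "(real \<Rightarrow> 'k \<times> 'k) list"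
    using that by (auto simp: finsupp_def)
  then show ?thesis
    using assms by (simp add: tensor_def cinner_of_words kform_def)
qed

lemma of_words_eq_sum:
  fixes f :: "(real \<Rightarrow> 'k::{real_inner,polish_space} \<times> 'k) list \<Rightarrow> complex"
  assumes "finite A" "A \<subseteq> fock_words" "{w. f w \<noteq> 0} \<subseteq> A"
  shows "of_words f = (\<Sum>w\<in>A. f w *\<^sub>C tensor w)"
  using assms
proof (induction A arbitrary: f rule: finite_induct)
  case empty
  then have "f = (\<lambda>_. 0)" by auto
  then show ?case by (simp add: of_words_def zero_fock.abs_eq[symmetric])
next
  case (insert v A)
  let ?C = "kCauchy (finsupp fock_words) fock_kernel"
  let ?g = "\<lambda>w. if w = v then 0 else f w"
  let ?e = "\<lambda>w. if w = v then (1::complex) else 0"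
  have e: "?e \<in> finsupp fock_words"
    using insert.prems by (auto simp: finsupp_def)
  have g: "?g \<in> finsupp fock_words"
    using insert.prems insert.hyps unfolding finsupp_def
    by (auto intro: finite_subset[of _ A])
  have "of_words f = abs_fock (\<lambda>_ w. f v * ?e w + ?g w)"
    unfolding of_words_def by (rule arg_cong[where f = abs_fock], intro ext) simp
  also have "\<dots> = f v *\<^sub>C tensor v + of_words ?g"
  proof -
    have "cscale_fock (f v) (abs_fock (\<lambda>_. ?e)) = abs_fock (\<lambda>_ w. f v * ?e w)"
      by (rule cscale_fock.abs_eq, unfold krel_iff_eq, rule fock.Cs_const[OF e])
    moreover have "abs_fock (\<lambda>_ w. f v * ?e w) + abs_fock (\<lambda>_. ?g) = abs_fock (\<lambda>_ w. f v * ?e w + ?g w)"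
      by (rule plus_fock.abs_eq, unfold krel_iff_eq)
        (rule fock.Cs_const[OF fock.fs_scale[OF e]], rule fock.Cs_const[OF g])
    ultimately show ?thesis
      unfolding scaleC_fock_def tensor_def of_words_def by (simp only:)
  qed
  also have "of_words ?g = (\<Sum>w\<in>A. ?g w *\<^sub>C tensor w)"
    using insert.prems insert.hyps by (intro insert.IH) auto
  also have "\<dots> = (\<Sum>w\<in>A. f w *\<^sub>C tensor w)"
    using insert.hyps by (intro sum.cong) auto
  finally show ?case using insert.hyps by simp
qed

lemma tensors_dense:
  "closure {\<Sum>w\<in>A. c w *\<^sub>C tensor w |A c. finite A \<and> A \<subseteq> fock_words}
     = (UNIV :: 'k::{real_inner,polish_space} fock set)"
proof -
  let ?D = "{\<Sum>w\<in>A. c w *\<^sub>C tensor w |A c. finite A \<and> A \<subseteq> fock_words} :: 'k fock set"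
  have "x \<in> closure ?D" for x
    unfolding closure_approachable
  proof (intro allI impI)
    fix e :: real assume e: "e > 0"
    obtain s where s: "kCauchy (finsupp fock_words) fock_kernel s" "x = abs_fock s"
      by (rule fock_cases)
    obtain N where N: "dist (abs_fock s) (of_words (s N)) < e"
      using dist_of_words_tail[OF s(1) e] by blast
    have "of_words (s N) = (\<Sum>w | s N w \<noteq> 0. s N w *\<^sub>C tensor w)"
      using fock.CsD[OF s(1), of N] by (intro of_words_eq_sum) (auto simp: finsupp_def)
    then have "of_words (s N) \<in> ?D"
      using fock.CsD[OF s(1), of N] by (auto simp: finsupp_def)
    then show "\<exists>y\<in>?D. dist y x < e"
      using N s(2) by (intro bexI[of _ "of_words (s N)"]) (simp_all only: dist_commute)
  qed
  then show ?thesis by blast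
qed


section \<open>Von Neumann algebras and \<open>E\<^sub>0\<close>-semigroups\<close>

definition bops :: "('h::chilbert_space \<Rightarrow> 'h) set" where
  "bops = {A. bounded_linear A \<and> (\<forall>c x. A (c *\<^sub>C x) = c *\<^sub>C A x)}"

definition hadj :: "('h::chilbert_space \<Rightarrow> 'h) \<Rightarrow> 'h \<Rightarrow> 'h" where
  "hadj A = (THE B. \<forall>x y. cinner (B x) y = cinner x (A y))"

definition commutant :: "('h::chilbert_space \<Rightarrow> 'h) set \<Rightarrow> ('h \<Rightarrow> 'h) set" where
  "commutant S = {A \<in> bops. \<forall>B\<in>S. A \<circ> B = B \<circ> A}"

definition von_neumann_algebra :: "('h::chilbert_space \<Rightarrow> 'h) set \<Rightarrow> bool" where
  "von_neumann_algebra M \<longleftrightarrow> M \<subseteq> bops \<and> (\<forall>x\<in>M. hadj x \<in> M) \<and> commutant (commutant M) = M"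

text \<open>
  The predual, consisting of the \<open>\<sigma>\<close>-weakly continuous functionals on \<open>M\<close>; as functions they
  are only constrained on \<open>M\<close>.
\<close>

definition predual :: "('h::chilbert_space \<Rightarrow> 'h) set \<Rightarrow> (('h \<Rightarrow> 'h) \<Rightarrow> complex) set" where
  "predual M = {\<rho>. \<exists>a b :: nat \<Rightarrow> 'h. summable (\<lambda>k. (norm (a k))\<^sup>2) \<and> summable (\<lambda>k. (norm (b k))\<^sup>2) \<and>
     (\<forall>x\<in>M. \<rho> x = (\<Sum>k. cinner (a k) (x (b k))))}"

definition normal_unital_star_endo ::
    "('h::chilbert_space \<Rightarrow> 'h) set \<Rightarrow> (('h \<Rightarrow> 'h) \<Rightarrow> ('h \<Rightarrow> 'h)) \<Rightarrow> bool" where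
  "normal_unital_star_endo M \<phi> \<longleftrightarrow>
     \<phi> ` M \<subseteq> M \<and>
     (\<forall>x\<in>M. \<forall>y\<in>M. \<phi> (\<lambda>\<xi>. x \<xi> + y \<xi>) = (\<lambda>\<xi>. \<phi> x \<xi> + \<phi> y \<xi>)) \<and>
     (\<forall>c. \<forall>x\<in>M. \<phi> (\<lambda>\<xi>. c *\<^sub>C x \<xi>) = (\<lambda>\<xi>. c *\<^sub>C \<phi> x \<xi>)) \<and>
     (\<forall>x\<in>M. \<forall>y\<in>M. \<phi> (x \<circ> y) = \<phi> x \<circ> \<phi> y) \<and>
     (\<forall>x\<in>M. \<phi> (hadj x) = hadj (\<phi> x)) \<and>
     \<phi> id = id \<and>
     (\<forall>\<rho>\<in>predual M. (\<lambda>x. \<rho> (\<phi> x)) \<in> predual M)"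

text \<open>Families indexed by \<open>t \<ge> 0\<close> are functions on the reals, whose values at \<open>t < 0\<close> play no role.\<close>

definition E0_semigroup ::
    "('h::chilbert_space \<Rightarrow> 'h) set \<Rightarrow> (real \<Rightarrow> ('h \<Rightarrow> 'h) \<Rightarrow> ('h \<Rightarrow> 'h)) \<Rightarrow> bool" where
  "E0_semigroup M \<alpha> \<longleftrightarrow>
     von_neumann_algebra M \<and>
     (\<forall>t\<ge>0. normal_unital_star_endo M (\<alpha> t)) \<and>
     (\<forall>x\<in>M. \<alpha> 0 x = x) \<and>
     (\<forall>s\<ge>0. \<forall>t\<ge>0. \<forall>x\<in>M. \<alpha> (s + t) x = \<alpha> s (\<alpha> t x)) \<and>
     (\<forall>t>0. \<alpha> t ` M \<noteq> M) \<and>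
     (\<forall>x\<in>M. \<forall>\<rho>\<in>predual M. continuous_on {0..} (\<lambda>t. \<rho> (\<alpha> t x)))"


section \<open>The gauge index\<close>

text \<open>
  Cocycles are required to be extensional, i.e. to take a fixed value at \<open>t < 0\<close>, so that they
  correspond exactly to families indexed by \<open>t \<ge> 0\<close>.
\<close>

definition cocycle ::
    "('h::chilbert_space \<Rightarrow> 'h) set \<Rightarrow> (real \<Rightarrow> ('h \<Rightarrow> 'h) \<Rightarrow> ('h \<Rightarrow> 'h)) \<Rightarrow> (real \<Rightarrow> 'h \<Rightarrow> 'h) \<Rightarrow> bool" where
  "cocycle M \<alpha> U \<longleftrightarrow>
     U \<in> extensional {0..} \<and>
     (\<forall>t\<ge>0. U t \<in> M \<and> hadj (U t) \<circ> U t = id \<and> U t \<circ> hadj (U t) = id) \<and>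
     (\<forall>\<xi>. continuous_on {0..} (\<lambda>t. U t \<xi>)) \<and>
     (\<forall>s\<ge>0. \<forall>t\<ge>0. U s \<circ> \<alpha> s (U t) = U (s + t))"

definition gauge_cocycles ::
    "('h::chilbert_space \<Rightarrow> 'h) set \<Rightarrow> (real \<Rightarrow> ('h \<Rightarrow> 'h) \<Rightarrow> ('h \<Rightarrow> 'h)) \<Rightarrow> (real \<Rightarrow> 'h \<Rightarrow> 'h) set" where
  "gauge_cocycles M \<alpha> = {U. cocycle M \<alpha> U \<and> (\<forall>t\<ge>0. U t \<in> M \<inter> commutant (\<alpha> t ` M))}"

definition c_star ::
    "(('h::chilbert_space \<Rightarrow> 'h) \<Rightarrow> complex) \<Rightarrow> (real \<Rightarrow> 'h \<Rightarrow> 'h) \<Rightarrow> (real \<Rightarrow> 'h \<Rightarrow> 'h) \<Rightarrow> complex" where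
  "c_star \<tau> U V = (THE c. \<forall>t\<ge>0. \<tau> (hadj (U t) \<circ> V t) = exp (c * of_real t))"

definition sum_zero_functions :: "'x set \<Rightarrow> ('x \<Rightarrow> complex) set" where
  "sum_zero_functions G = {f \<in> finsupp G. (\<Sum>U | f U \<noteq> 0. f U) = 0}"

text \<open>Meant for a \<open>II\<^sub>1\<close> factor \<open>M\<close>, with \<open>\<tau>\<close> its trace.\<close>

definition gauge_index ::
    "('h::chilbert_space \<Rightarrow> 'h) set \<Rightarrow> (('h \<Rightarrow> 'h) \<Rightarrow> complex) \<Rightarrow>
     (real \<Rightarrow> ('h \<Rightarrow> 'h) \<Rightarrow> ('h \<Rightarrow> 'h)) \<Rightarrow> enat" where
  "gauge_index M \<tau> \<alpha> =
     hilbert_dim (khilbert (sum_zero_functions (gauge_cocycles M \<alpha>)) (c_star \<tau>)) (kinner (c_star \<tau>))"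


section \<open>The free flow\<close>

text \<open>
  The left creation operator of \<open>f \<in> L2\<close>; bounded operators are determined by their values on
  elementary tensors by \<open>tensors_dense\<close>.
\<close>

definition creation :: "(real \<Rightarrow> 'k::{real_inner,polish_space}) \<Rightarrow> 'k fock \<Rightarrow> 'k fock" where
  "creation f = (THE A. A \<in> bops \<and> (\<forall>w\<in>fock_words. A (tensor w) = tensor ((\<lambda>x. (f x, 0)) # w)))"

definition semicircular :: "(real \<Rightarrow> 'k::{real_inner,polish_space}) \<Rightarrow> 'k fock \<Rightarrow> 'k fock" where
  "semicircular f = (\<lambda>\<xi>. (creation f \<xi> + hadj (creation f) \<xi>) /\<^sub>R 2)"

definition free_algebra :: "('k::{real_inner,polish_space} fock \<Rightarrow> 'k fock) set" where
  "free_algebra = commutant (commutant (semicircular ` L2))"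

text \<open>The vacuum is a trace vector for \<open>free_algebra\<close>, so this is the trace of that \<open>II\<^sub>1\<close> factor.\<close>

definition vacuum_trace :: "('k::{real_inner,polish_space} fock \<Rightarrow> 'k fock) \<Rightarrow> complex" where
  "vacuum_trace x = cinner \<Omega> (x \<Omega>)"

definition right_shift :: "real \<Rightarrow> (real \<Rightarrow> 'k::zero) \<Rightarrow> real \<Rightarrow> 'k" where
  "right_shift t f s = (if s < t then 0 else f (s - t))"

text \<open>
  The free flow is the unique \<open>E\<^sub>0\<close>-semigroup, up to irrelevant values outside \<open>free_algebra\<close> and
  at \<open>t < 0\<close>, with the following property; its rank is the dimension of \<open>'k\<close>.
\<close>

definition is_free_flow ::
    "(real \<Rightarrow> ('k::{real_inner,polish_space} fock \<Rightarrow> 'k fock) \<Rightarrow> ('k fock \<Rightarrow> 'k fock)) \<Rightarrow> bool" where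
  "is_free_flow \<gamma> \<longleftrightarrow>
     E0_semigroup free_algebra \<gamma> \<and>
     (\<forall>t\<ge>0. \<forall>f\<in>L2. \<gamma> t (semicircular f) = semicircular (right_shift t f))"

end

theory Submission
  imports Defs
begin

text \<open>
  Gauge cocycles of the free flow are scalar. Let \<open>x\<close> commute with \<open>s(e)\<close> for all real \<open>e\<close>
  supported in \<open>[t, \<infinity>)\<close>, and let \<open>\<xi>\<close> be the component of \<open>x \<Omega>\<close> orthogonal to \<open>\<Omega>\<close>. The right
  semicircular operators \<open>(r(e) + r(e)\<^sup>*) / 2\<close> commute with the algebra and agree with \<open>s(e)\<close> on
  \<open>\<Omega>\<close>, so \<open>(l(e) + l(e)\<^sup>*) \<xi> = (r(e) + r(e)\<^sup>*) \<xi>\<close>. For a unit vector \<open>e\<close> this yields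
  \<open>2 \<parallel>\<xi>\<parallel>\<^sup>2 = \<parallel>l(e)\<^sup>* \<xi>\<parallel>\<^sup>2 + \<parallel>r(e)\<^sup>* \<xi>\<parallel>\<^sup>2\<close>, and the right-hand side tends to \<open>0\<close> along an
  orthonormal sequence. Hence \<open>\<xi> = 0\<close>, and \<open>x\<close> is a scalar because \<open>\<Omega>\<close> is separating. A gauge
  cocycle is therefore a continuous character \<open>exp(\<kappa>\<^sub>U t)\<close>, so that \<open>c\<^sub>*(U, V) = cnj \<kappa>\<^sub>U + \<kappa>\<^sub>V\<close>,
  and such a kernel induces the zero form on functions of total sum \<open>0\<close>.
\<close>


section \<open>Complex Hilbert spaces and operators\<close>

lemma cinner_add_left: "cinner (x + y) z = cinner x z + cinner y (z::'h::chilbert_space)"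
  by (metis cinner_add_right cinner_commute complex_cnj_add)

lemma cinner_scaleC_left: "cinner (c *\<^sub>C x) y = cnj c * cinner x (y::'h::chilbert_space)"
  by (metis cinner_scaleC_right cinner_commute complex_cnj_mult)

lemma scaleC_one [simp]: "1 *\<^sub>C x = (x::'h::chilbert_space)"
  using scaleC_of_real[of 1 x] by simp

lemma scaleC_zero_left [simp]: "0 *\<^sub>C x = (0::'h::chilbert_space)"
  using scaleC_of_real[of 0 x] by simp

lemma scaleC_minus_one: "(-1) *\<^sub>C x = - (x::'h::chilbert_space)"
  using scaleC_of_real[of "-1" x] by simp

lemma scaleC_zero_right [simp]: "c *\<^sub>C 0 = (0::'h::chilbert_space)"
  using scaleC_scaleC[of c 0 0] by simp

lemma cinner_zero_right [simp]: "cinner x 0 = (0::complex)" for x :: "'h::chilbert_space"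
  using cinner_scaleC_right[of x 0 0] by simp

lemma cinner_zero_left [simp]: "cinner 0 x = (0::complex)" for x :: "'h::chilbert_space"
  using cinner_scaleC_left[of 0 0 x] by simp

lemma cinner_minus_right: "cinner x (- y) = - cinner x y" for x :: "'h::chilbert_space"
  using cinner_scaleC_right[of x "-1" y] by (simp add: scaleC_minus_one)

lemma cinner_diff_right: "cinner x (y - z) = cinner x y - cinner x z" for x :: "'h::chilbert_space"
  using cinner_add_right[of x y "- z"] by (simp add: cinner_minus_right)

lemma cinner_minus_left: "cinner (- x) y = - cinner x y" for x :: "'h::chilbert_space"
  using cinner_scaleC_left[of "-1" x y] by (simp add: scaleC_minus_one)

lemma cinner_diff_left: "cinner (x - y) z = cinner x z - cinner y z" for x :: "'h::chilbert_space"
  using cinner_add_left[of x "- y" z] by (simp add: cinner_minus_left)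

lemma cinner_sum_right: "cinner x (\<Sum>i\<in>I. f i) = (\<Sum>i\<in>I. cinner x (f i))"
  for x :: "'h::chilbert_space"
  by (induction I rule: infinite_finite_induct) (auto simp: cinner_add_right)

lemma cinner_sum_left: "cinner (\<Sum>i\<in>I. f i) x = (\<Sum>i\<in>I. cinner (f i) x)"
  for x :: "'h::chilbert_space"
  by (induction I rule: infinite_finite_induct) (auto simp: cinner_add_left)

lemma scaleC_diff_right: "c *\<^sub>C (x - y) = c *\<^sub>C x - c *\<^sub>C (y::'h::chilbert_space)"
  using scaleC_add_right[of c "x - y" y] by simp

lemma scaleC_sum_right: "c *\<^sub>C (\<Sum>i\<in>I. f i) = (\<Sum>i\<in>I. c *\<^sub>C f i)"
  for f :: "'i \<Rightarrow> 'h::chilbert_space"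
  by (induction I rule: infinite_finite_induct) (auto simp: scaleC_add_right)

lemma cinner_self: "cinner x x = of_real ((norm x)\<^sup>2)" for x :: "'h::chilbert_space"
proof -
  have "Im (cinner x x) = 0"
    using cinner_commute[of x x] by (simp add: complex_eq_iff)
  moreover have "Re (cinner x x) = (norm x)\<^sup>2"
    by (simp add: inner_eq_Re_cinner[symmetric] power2_norm_eq_inner)
  ultimately show ?thesis by (simp add: complex_eq_iff)
qed

text \<open>Since Im z = Re (-\<i> z), the complex form is recovered from the real inner product;
  its continuity and bounds are inherited this way.\<close>

lemma cinner_eq_Complex: "cinner x y = Complex (x \<bullet> y) (x \<bullet> ((- \<i>) *\<^sub>C y))"
  for x :: "'h::chilbert_space"
  by (simp add: inner_eq_Re_cinner cinner_scaleC_right complex_eq_iff)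

lemma cinner_ext: "(\<And>y. cinner y x = cinner y z) \<Longrightarrow> x = z" for x :: "'h::chilbert_space"
  using inner_eq_Re_cinner[of "x - z" "x - z"] by (simp add: cinner_diff_right)

text \<open>The norm belongs to the real structure, so complex homogeneity is recovered through
  \<open>cinner_self\<close>.\<close>

lemma norm_scaleC: "norm (c *\<^sub>C x) = cmod c * norm x" for x :: "'h::chilbert_space"
proof -
  have "complex_of_real ((norm (c *\<^sub>C x))\<^sup>2) = (c * cnj c) * cinner x x"
    by (simp only: cinner_self[symmetric] cinner_scaleC_left cinner_scaleC_right mult_ac)
  also have "\<dots> = complex_of_real ((cmod c * norm x)\<^sup>2)"
    by (simp add: cinner_self complex_norm_square[symmetric] power_mult_distrib)
  finally have "(norm (c *\<^sub>C x))\<^sup>2 = (cmod c * norm x)\<^sup>2" by (simp only: of_real_eq_iff)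
  then show ?thesis by (simp add: power2_eq_iff_nonneg)
qed

lemma scaleR_eq_scaleC: "r *\<^sub>R x = of_real r *\<^sub>C (x::'h::chilbert_space)"
  by (simp add: scaleC_of_real)

lemma scaleC_left_commute: "a *\<^sub>C b *\<^sub>C x = b *\<^sub>C a *\<^sub>C (x::'h::chilbert_space)"
  by (simp add: scaleC_scaleC mult.commute)

lemma bounded_linear_scaleC: "bounded_linear (\<lambda>x::'h::chilbert_space. c *\<^sub>C x)"
proof (rule bounded_linear_intro)
  show "c *\<^sub>C (r *\<^sub>R x) = r *\<^sub>R c *\<^sub>C x" for r and x :: 'h
    by (simp add: scaleR_eq_scaleC scaleC_left_commute)
  show "norm (c *\<^sub>C x) \<le> norm x * cmod c" for x :: 'h by (simp add: norm_scaleC)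
qed (rule scaleC_add_right)

lemma continuous_on_scaleC [continuous_intros]:
  "continuous_on S f \<Longrightarrow> continuous_on S (\<lambda>x. c *\<^sub>C (f x :: 'h::chilbert_space))"
  by (rule bounded_linear.continuous_on[OF bounded_linear_scaleC])

lemma continuous_on_cinner [continuous_intros]:
  fixes f g :: "'t::topological_space \<Rightarrow> 'h::chilbert_space"
  assumes "continuous_on S f" "continuous_on S g"
  shows "continuous_on S (\<lambda>x. cinner (f x) (g x))"
  unfolding cinner_eq_Complex Complex_eq by (intro continuous_intros assms)

section \<open>Bounded complex-linear operators and adjoints\<close>

lemma bopsD:
  fixes A :: "'h::chilbert_space \<Rightarrow> 'h"
  assumes "A \<in> bops"
  shows "A (x + y) = A x + A y" "A (x - y) = A x - A y" "A (c *\<^sub>C x) = c *\<^sub>C A x"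
    "A (r *\<^sub>R x) = r *\<^sub>R A x" "A 0 = 0"
    "A (\<Sum>i\<in>I. f i) = (\<Sum>i\<in>I. A (f i))"
  using assms unfolding bops_def
  by (auto simp: linear_simps bounded_linear.linear linear_sum)

lemma bops_continuous:
  fixes A :: "'h::chilbert_space \<Rightarrow> 'h"
  shows "A \<in> bops \<Longrightarrow> continuous_on S f \<Longrightarrow> continuous_on S (\<lambda>x. A (f x))"
  unfolding bops_def by (auto intro: bounded_linear.continuous_on)

lemma bops_add: "A \<in> bops \<Longrightarrow> B \<in> bops \<Longrightarrow> (\<lambda>x. A x + B x) \<in> bops"
  unfolding bops_def by (auto simp: bounded_linear_add scaleC_add_right)

lemma bops_comp: "A \<in> bops \<Longrightarrow> B \<in> bops \<Longrightarrow> A \<circ> B \<in> bops"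
  unfolding bops_def by (auto simp: o_def intro: bounded_linear_compose)

lemma bops_scaleC: "(\<lambda>x::'h::chilbert_space. c *\<^sub>C x) \<in> bops"
  unfolding bops_def by (auto simp: bounded_linear_scaleC scaleC_left_commute)

lemma bops_scaleR: "A \<in> bops \<Longrightarrow> (\<lambda>x. r *\<^sub>R A x) \<in> bops"
  using bops_comp[OF bops_scaleC, of A "of_real r"] by (simp add: o_def scaleR_eq_scaleC)

lemma bops_id: "(id :: 'h::chilbert_space \<Rightarrow> 'h) \<in> bops"
  unfolding bops_def by (auto simp: id_def bounded_linear_ident)

text \<open>The relation inside the definite description \<open>hadj\<close>. Uniqueness is
  automatic by nondegeneracy, so exhibiting one such \<open>B\<close> evaluates
  \<open>hadj A\<close>.\<close>

definition is_adjoint :: "('h::chilbert_space \<Rightarrow> 'h) \<Rightarrow> ('h \<Rightarrow> 'h) \<Rightarrow> bool" where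
  "is_adjoint B A \<longleftrightarrow> (\<forall>x y. cinner (B x) y = cinner x (A y))"

lemma is_adjoint_right: "is_adjoint B A \<Longrightarrow> cinner x (B y) = cinner (A x) y"
  unfolding is_adjoint_def by (metis cinner_commute)

lemma hadj_eqI:
  assumes "is_adjoint B A"
  shows "hadj A = B"
  unfolding hadj_def
proof (rule the_equality)
  show "\<forall>x y. cinner (B x) y = cinner x (A y)" using assms by (simp add: is_adjoint_def)
  fix C assume C: "\<forall>x y. cinner (C x) y = cinner x (A y)"
  have "cinner y (C x) = cinner y (B x)" for x y
    using assms C unfolding is_adjoint_def by (metis cinner_commute)
  then show "C = B" by (intro ext cinner_ext)
qed

lemma is_adjoint_scaleC: "is_adjoint (\<lambda>x. cnj c *\<^sub>C x) (\<lambda>x::'h::chilbert_space. c *\<^sub>C x)"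
  by (simp add: is_adjoint_def cinner_scaleC_left cinner_scaleC_right)

text \<open>Bessel's inequality for the pairwise orthogonal ranges of the isometries.\<close>

lemma adjoint_orthogonal_isometries_tendsto_0:
  fixes A B :: "nat \<Rightarrow> 'h::chilbert_space \<Rightarrow> 'h"
  assumes adj: "\<And>n. is_adjoint (B n) (A n)"
    and orth: "\<And>m n x. B m (A n x) = (if m = n then x else 0)"
  shows "(\<lambda>n. B n x) \<longlonglongrightarrow> 0"
proof -
  have le: "(\<Sum>n<N. (norm (B n x))\<^sup>2) \<le> (norm x)\<^sup>2" for N
  proof -
    \<comment> \<open>\<open>y\<close> is the projection of \<open>x\<close> onto the span of the
      first \<open>N\<close> ranges; expanding the norm of \<open>x - y\<close> gives the
      inequality.\<close>
    define y where "y = (\<Sum>n<N. A n (B n x))"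
    have xy: "cinner x y = of_real (\<Sum>n<N. (norm (B n x))\<^sup>2)"
      using adj unfolding is_adjoint_def
      by (simp add: y_def cinner_sum_right cinner_self[symmetric] of_real_sum del: of_real_power)
    have "cinner y y = (\<Sum>n<N. \<Sum>m<N. cinner (A m (B m x)) (A n (B n x)))"
      by (simp add: y_def cinner_sum_right cinner_sum_left)
    also have "\<dots> = (\<Sum>n<N. \<Sum>m<N. if m = n then cinner (B n x) (B n x) else 0)"
      by (intro sum.cong refl)
        (auto simp: is_adjoint_right[OF adj, symmetric] orth
          intro: trans[OF is_adjoint_right[OF adj, symmetric]])
    also have "\<dots> = of_real (\<Sum>n<N. (norm (B n x))\<^sup>2)"
      by (simp add: sum.delta cinner_self)
    finally have yy: "cinner y y = of_real (\<Sum>n<N. (norm (B n x))\<^sup>2)" .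
    have "0 \<le> (norm (x - y))\<^sup>2" by simp
    also have "(norm (x - y))\<^sup>2 = (norm x)\<^sup>2 - (\<Sum>n<N. (norm (B n x))\<^sup>2)"
    proof -
      have "complex_of_real ((norm (x - y))\<^sup>2) = cinner x x - cinner x y - cnj (cinner x y) + cinner y y"
        using cinner_commute[of y x]
        by (simp only: cinner_self[symmetric]) (simp add: cinner_diff_left cinner_diff_right)
      also have "\<dots> = of_real ((norm x)\<^sup>2 - (\<Sum>n<N. (norm (B n x))\<^sup>2))"
        by (simp add: xy yy cinner_self[of x])
      finally show ?thesis by (simp only: of_real_eq_iff)
    qed
    finally show ?thesis by simp
  qed
  have "summable (\<lambda>n. (norm (B n x))\<^sup>2)"
    by (rule summableI_nonneg_bounded[OF _ le]) simp
  then have "(\<lambda>n. (norm (B n x))\<^sup>2) \<longlonglongrightarrow> 0" by (rule summable_LIMSEQ_zero)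
  then have "(\<lambda>n. sqrt ((norm (B n x))\<^sup>2)) \<longlonglongrightarrow> sqrt 0" by (rule tendsto_real_sqrt)
  then show ?thesis by (simp add: tendsto_norm_zero_iff)
qed

text \<open>The family \<open>S\<close> may be linearly dependent, as elementary tensors are. The
  bound on all finite combinations makes the prescription well defined and Lipschitz on the span,
  hence extendable to the closure.\<close>

lemma linear_extension:
  fixes S T :: "'w \<Rightarrow> 'h::chilbert_space"
  assumes dense: "closure {\<Sum>w\<in>W. c w *\<^sub>C S w |W c. finite W \<and> W \<subseteq> X} = UNIV"
    and bound: "\<And>W c. finite W \<Longrightarrow> W \<subseteq> X \<Longrightarrow>
      norm (\<Sum>w\<in>W. c w *\<^sub>C T w) \<le> C * norm (\<Sum>w\<in>W. c w *\<^sub>C S w)"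
  shows "\<exists>F\<in>bops. \<forall>w\<in>X. F (S w) = T w"
proof -
  define D where "D = {\<Sum>w\<in>W. c w *\<^sub>C S w |W c. finite W \<and> W \<subseteq> X}"
  \<comment> \<open>The graph of the prescribed map; a vector of \<open>D\<close> can have many
    representations, so single-valuedness has to be proved.\<close>
  define G where "G = {(\<Sum>w\<in>W. c w *\<^sub>C S w, \<Sum>w\<in>W. c w *\<^sub>C T w) |W c. finite W \<and> W \<subseteq> X}"
  have Gadd: "(x + d *\<^sub>C x', y + d *\<^sub>C y') \<in> G" if xy: "(x, y) \<in> G" "(x', y') \<in> G" for x y x' y' d
  proof -
    obtain W c where W: "finite W" "W \<subseteq> X" "x = (\<Sum>w\<in>W. c w *\<^sub>C S w)" "y = (\<Sum>w\<in>W. c w *\<^sub>C T w)"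
      using xy(1) unfolding G_def by blast
    obtain V e where V: "finite V" "V \<subseteq> X" "x' = (\<Sum>w\<in>V. e w *\<^sub>C S w)" "y' = (\<Sum>w\<in>V. e w *\<^sub>C T w)"
      using xy(2) unfolding G_def by blast
    \<comment> \<open>Coefficients are arbitrary outside their own index sets, so they are cut off
      before being added over the union.\<close>
    define h where "h w = (if w \<in> W then c w else 0) + d * (if w \<in> V then e w else 0)" for w
    have "(\<Sum>w\<in>W \<union> V. h w *\<^sub>C R w) = (\<Sum>w\<in>W. c w *\<^sub>C R w) + d *\<^sub>C (\<Sum>w\<in>V. e w *\<^sub>C R w)"
      for R :: "'w \<Rightarrow> 'h"
    proof -
      have "(\<Sum>w\<in>W \<union> V. h w *\<^sub>C R w) = (\<Sum>w\<in>W \<union> V. (if w \<in> W then c w *\<^sub>C R w else 0))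
          + (\<Sum>w\<in>W \<union> V. (if w \<in> V then d *\<^sub>C e w *\<^sub>C R w else 0))"
        unfolding sum.distrib[symmetric] h_def
        by (intro sum.cong) (auto simp: scaleC_add_left scaleC_scaleC)
      also have "\<dots> = (\<Sum>w\<in>(W \<union> V) \<inter> W. c w *\<^sub>C R w) + (\<Sum>w\<in>(W \<union> V) \<inter> V. d *\<^sub>C e w *\<^sub>C R w)"
        using W V by (simp only: sum.inter_restrict finite_Un simp_thms)
      finally show ?thesis
        by (simp add: Int_absorb1 scaleC_sum_right)
    qed
    then show ?thesis
      unfolding G_def W V using W(1,2) V(1,2)
      by (intro CollectI exI[of _ "W \<union> V"] exI[of _ h]) simp
  qed
  have Gb: "norm y \<le> C * norm x" if "(x, y) \<in> G" for x y
    using that bound unfolding G_def by blast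
  have Gb': "norm (y' - y) \<le> C * norm (x' - x)" if "(x, y) \<in> G" "(x', y') \<in> G" for x y x' y'
    using Gb[OF Gadd[OF that(2,1), of "-1"]] by (simp add: scaleC_minus_one)
  have "\<exists>f. \<forall>x\<in>D. (x, f x) \<in> G"
    unfolding D_def G_def by (intro bchoice) blast
  then obtain f where f: "\<And>x. x \<in> D \<Longrightarrow> (x, f x) \<in> G" by blast
  have GD: "(x, y) \<in> G \<Longrightarrow> x \<in> D" for x y unfolding D_def G_def by blast
  \<comment> \<open>Two values over the same point are at distance at most
    \<open>C * 0\<close>.\<close>
  have fG: "f x = y" if "(x, y) \<in> G" for x y
    using Gb'[OF f[OF GD[OF that]] that] by simp
  \<comment> \<open>A Lipschitz constant must be nonnegative, which is not assumed of
    \<open>C\<close>.\<close>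
  have "(max C 0)-lipschitz_on D f"
    using order_trans[OF Gb'[OF f f] mult_right_mono[of C "max C 0"]]
    by (intro lipschitz_onI) (auto simp: dist_norm)
  then have "uniformly_continuous_on D f" by (rule lipschitz_on_uniformly_continuous)
  then obtain g where g: "uniformly_continuous_on (closure D) g" "\<And>x. x \<in> D \<Longrightarrow> f x = g x"
    using uniformly_continuous_on_extension_on_closure by metis
  have cl: "closure D = UNIV" using dense by (simp add: D_def)
  have cont: "continuous_on UNIV g"
    using g(1) by (simp add: cl uniformly_continuous_imp_continuous)
  have ind: "P x" if "closed {x. P x}" "\<And>x. x \<in> D \<Longrightarrow> P x" for P x
    using closure_minimal[of D "{x. P x}"] that cl by auto
  have contg: "continuous_on UNIV h \<Longrightarrow> continuous_on UNIV (\<lambda>x. g (h x))" for h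
    using continuous_on_compose2[OF cont] by blast
  \<comment> \<open>Additivity and homogeneity travel as one identity, extended from
    \<open>D\<close> to its closure one variable at a time.\<close>
  have D1: "g (x + d *\<^sub>C x') = g x + d *\<^sub>C g x'" if "x \<in> D" "x' \<in> D" for x x' d
    using fG[OF Gadd[OF f[OF that(1)] f[OF that(2)], of d]] g(2) that
      GD[OF Gadd[OF f[OF that(1)] f[OF that(2)], of d]] by simp
  have D2: "g (x + d *\<^sub>C x') = g x + d *\<^sub>C g x'" if "x \<in> D" for x x' d
    by (rule ind[of "\<lambda>x'. g (x + d *\<^sub>C x') = g x + d *\<^sub>C g x'"], intro closed_Collect_eq)
      (auto intro!: continuous_intros contg cont D1 that)
  have D3: "g (x + d *\<^sub>C x') = g x + d *\<^sub>C g x'" for x x' d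
    by (rule ind[of "\<lambda>x. g (x + d *\<^sub>C x') = g x + d *\<^sub>C g x'"], intro closed_Collect_eq)
      (auto intro!: continuous_intros contg cont D2)
  have D4: "norm (g x) \<le> C * norm x" for x
    by (rule ind[of "\<lambda>x. norm (g x) \<le> C * norm x"], intro closed_Collect_le)
      (use Gb[OF f] g(2) in \<open>auto intro!: continuous_intros contg cont\<close>)
  have add: "g (x + y) = g x + g y" for x y using D3[of x 1 y] by simp
  have g0: "g 0 = 0" using add[of 0 0] by simp
  have sc: "g (d *\<^sub>C x) = d *\<^sub>C g x" for d x using D3[of 0 d x] g0 by simp
  have "g \<in> bops"
    unfolding bops_def
  proof (intro CollectI conjI allI bounded_linear_intro)
    show "g (r *\<^sub>R x) = r *\<^sub>R g x" for r x by (simp add: scaleR_eq_scaleC sc)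
    show "norm (g x) \<le> norm x * C" for x using D4[of x] by (simp add: mult.commute)
  qed (simp_all add: add sc)
  moreover have "g (S w) = T w" if "w \<in> X" for w
  proof -
    have "(S w, T w) \<in> G"
      unfolding G_def using that
      by (intro CollectI exI[of _ "{w}"] exI[of _ "\<lambda>_. 1"]) simp
    then show ?thesis using fG GD g(2) by metis
  qed
  ultimately show ?thesis by blast
qed


section \<open>Creation operators on the full Fock space\<close>

lemma L2_inner_herm: "L2_inner f g = cnj (L2_inner g f)"
  unfolding L2_inner_def by (subst cplx_inner_herm) simp

lemma fock_kernel_Cons: "fock_kernel (f # u) (g # v) = L2_inner f g * fock_kernel u v"
  by (simp add: fock_kernel_def prod.lessThan_Suc_shift del: prod.lessThan_Suc)

lemma fock_kernel_snoc: "fock_kernel (u @ [f]) (v @ [g]) = L2_inner f g * fock_kernel u v"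
proof (cases "length u = length v")
  case True
  then have "(\<Prod>i<length u. L2_inner ((u @ [f]) ! i) ((v @ [g]) ! i))
      = (\<Prod>i<length u. L2_inner (u ! i) (v ! i))"
    by (intro prod.cong) (auto simp: nth_append)
  then show ?thesis using True by (simp add: fock_kernel_def nth_append mult.commute)
qed (simp add: fock_kernel_def)

lemma fock_words_simps [simp]:
  "[] \<in> fock_words" "f # w \<in> fock_words \<longleftrightarrow> f \<in> L2 \<and> w \<in> fock_words"
  "u @ w \<in> fock_words \<longleftrightarrow> u \<in> fock_words \<and> w \<in> fock_words"
  unfolding fock_words_def by auto

lemma cinner_tensor_Cons:
  fixes f g :: "real \<Rightarrow> 'k::{real_inner,polish_space} \<times> 'k"
  assumes "f \<in> L2" "g \<in> L2" "u \<in> fock_words" "v \<in> fock_words"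
  shows "cinner (tensor (f # u)) (tensor (g # v)) = L2_inner f g * cinner (tensor u) (tensor v)"
  using assms by (simp add: cinner_tensor fock_kernel_Cons)

lemma cinner_tensor_snoc:
  fixes f g :: "real \<Rightarrow> 'k::{real_inner,polish_space} \<times> 'k"
  assumes "f \<in> L2" "g \<in> L2" "u \<in> fock_words" "v \<in> fock_words"
  shows "cinner (tensor (u @ [f])) (tensor (v @ [g])) = L2_inner f g * cinner (tensor u) (tensor v)"
  using assms by (simp add: cinner_tensor fock_kernel_snoc)

lemma cinner_tensor_length:
  fixes u v :: "(real \<Rightarrow> 'k::{real_inner,polish_space} \<times> 'k) list"
  assumes "u \<in> fock_words" "v \<in> fock_words" "length u \<noteq> length v"
  shows "cinner (tensor u) (tensor v) = 0"
  using assms by (simp add: cinner_tensor fock_kernel_def)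

lemma cinner_vacuum: "cinner \<Omega> (\<Omega> :: 'k::{real_inner,polish_space} fock) = 1"
  by (simp add: vacuum_def cinner_tensor fock_kernel_def)

text \<open>Density as an induction rule: combinations of elementary tensors are dense, so a closed
  property stable under linear operations need only be checked on tensors.\<close>

lemma fock_induct [consumes 0, case_names closed add scaleC tensor]:
  fixes x :: "'k::{real_inner,polish_space} fock"
  assumes closed: "closed {x. P x}"
    and add: "\<And>x y. P x \<Longrightarrow> P y \<Longrightarrow> P (x + y)"
    and scale: "\<And>c x. P x \<Longrightarrow> P (c *\<^sub>C x)"
    and tensor: "\<And>w. w \<in> fock_words \<Longrightarrow> P (tensor w)"
  shows "P x"
proof -
  have "P 0" using scale[OF tensor[of "[]"], of 0] by simp
  have "P (\<Sum>w\<in>W. c w *\<^sub>C tensor w)" if "finite W" "W \<subseteq> fock_words" for W c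
    using that by (induction W rule: finite_induct) (auto intro: add scale tensor \<open>P 0\<close>)
  then have "closure {\<Sum>w\<in>W. c w *\<^sub>C tensor w |W c. finite W \<and> W \<subseteq> fock_words} \<subseteq> {x. P x}"
    by (intro closure_minimal closed) blast
  then show ?thesis unfolding tensors_dense by blast
qed

lemma bops_eqI:
  fixes A B :: "'k::{real_inner,polish_space} fock \<Rightarrow> 'k fock"
  assumes AB: "A \<in> bops" "B \<in> bops"
    and "\<And>w. w \<in> fock_words \<Longrightarrow> A (tensor w) = B (tensor w)"
  shows "A = B"
proof
  fix x show "A x = B x"
  proof (induction x rule: fock_induct)
    case closed
    show ?case by (intro closed_Collect_eq bops_continuous[OF AB(1)] bops_continuous[OF AB(2)] continuous_on_id)
  qed (use assms(3) in \<open>simp_all add: bopsD[OF AB(1)] bopsD[OF AB(2)]\<close>)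
qed

text \<open>Multiplying all inner products of the family by \<open>a\<close> multiplies the norm of
  every combination by the square root of \<open>cmod a\<close>, which is the bound for
  \<open>linear_extension\<close>.\<close>

lemma fock_operator_exists:
  fixes T :: "(real \<Rightarrow> 'k::{real_inner,polish_space} \<times> 'k) list \<Rightarrow> 'k fock"
  assumes T: "\<And>u v. u \<in> fock_words \<Longrightarrow> v \<in> fock_words \<Longrightarrow>
      cinner (T u) (T v) = a * cinner (tensor u) (tensor v)"
  shows "\<exists>F\<in>bops. \<forall>w\<in>fock_words. F (tensor w) = T w"
proof (rule linear_extension[OF tensors_dense, where C = "sqrt (cmod a)"])
  fix W :: "(real \<Rightarrow> 'k \<times> 'k) list set" and c
  assume W: "finite W" "W \<subseteq> fock_words"
  let ?x = "\<Sum>w\<in>W. c w *\<^sub>C tensor w" and ?y = "\<Sum>w\<in>W. c w *\<^sub>C T w"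
  have "cinner ?y ?y = (\<Sum>v\<in>W. \<Sum>u\<in>W. a * cinner (c u *\<^sub>C tensor u) (c v *\<^sub>C tensor v))"
    using W by (simp add: cinner_sum_left cinner_sum_right)
      (intro sum.cong refl, auto simp: cinner_scaleC_left cinner_scaleC_right T subset_iff)
  also have "\<dots> = a * cinner ?x ?x"
    by (simp add: cinner_sum_left cinner_sum_right sum_distrib_left)
  finally have "cmod (cinner ?y ?y) = cmod a * cmod (cinner ?x ?x)" by (simp only: norm_mult)
  then have "(norm ?y)\<^sup>2 = cmod a * (norm ?x)\<^sup>2" by (simp add: cinner_self norm_power)
  then have "sqrt ((norm ?y)\<^sup>2) = sqrt (cmod a * (norm ?x)\<^sup>2)" by simp
  then show "norm ?y \<le> sqrt (cmod a) * norm ?x" by (simp add: real_sqrt_mult)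
qed

text \<open>The candidate adjoint is known on tensors only. It is bounded because the squared norm
  of an image \<open>y\<close> of \<open>x\<close> is the inner product of \<open>A y\<close> with
  \<open>x\<close>, hence at most \<open>K\<close> times the product of the norms.\<close>

lemma fock_adjoint_exists:
  fixes T :: "(real \<Rightarrow> 'k::{real_inner,polish_space} \<times> 'k) list \<Rightarrow> 'k fock"
  assumes A: "A \<in> bops"
    and T: "\<And>v w. v \<in> fock_words \<Longrightarrow> w \<in> fock_words \<Longrightarrow>
      cinner (tensor v) (T w) = cinner (A (tensor v)) (tensor w)"
  shows "hadj A \<in> bops" "is_adjoint (hadj A) A" "w \<in> fock_words \<Longrightarrow> hadj A (tensor w) = T w"
proof -
  have "bounded_linear A" using A by (simp add: bops_def)
  then obtain K where K: "K \<ge> 0" "\<And>x. norm (A x) \<le> norm x * K"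
    using bounded_linear.nonneg_bounded by blast
  have "\<exists>F\<in>bops. \<forall>w\<in>fock_words. F (tensor w) = T w"
  proof (rule linear_extension[OF tensors_dense, where C = K])
    fix W :: "(real \<Rightarrow> 'k \<times> 'k) list set" and c
    assume W: "finite W" "W \<subseteq> fock_words"
    let ?x = "\<Sum>w\<in>W. c w *\<^sub>C tensor w" and ?y = "\<Sum>w\<in>W. c w *\<^sub>C T w"
    \<comment> \<open>The duality is extended from tensors to all \<open>z\<close> so that
      \<open>z = ?y\<close> may be inserted.\<close>
    have yx: "cinner z ?y = cinner (A z) ?x" for z
    proof (induction z rule: fock_induct)
      case closed
      show ?case by (intro closed_Collect_eq continuous_intros bops_continuous[OF A])
    next
      case (tensor v)
      then show ?case
        using W by (auto simp: cinner_sum_right cinner_scaleC_right T subset_iff intro!: sum.cong)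
    qed (simp_all add: bopsD[OF A] cinner_add_left cinner_scaleC_left)
    have "norm ?y * norm ?y = Re (cinner ?y ?y)" by (simp add: cinner_self power2_eq_square)
    also have "\<dots> = A ?y \<bullet> ?x" by (simp only: yx inner_eq_Re_cinner)
    also have "\<dots> \<le> norm (A ?y) * norm ?x" by (rule norm_cauchy_schwarz)
    also have "\<dots> \<le> norm ?y * K * norm ?x" by (intro mult_right_mono K) simp
    finally have "norm ?y * norm ?y \<le> norm ?y * (K * norm ?x)" by (simp only: mult.assoc)
    then show "norm ?y \<le> K * norm ?x"
      using K(1) by (cases "norm ?y = 0") (auto simp: mult_le_cancel_left)
  qed
  then obtain B where B: "B \<in> bops" "\<And>w. w \<in> fock_words \<Longrightarrow> B (tensor w) = T w" by blast
  \<comment> \<open>The adjoint relation is extended in two inductions, first in \<open>x\<close>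
    against tensors, then in \<open>y\<close>.\<close>
  have "cinner (B x) (tensor v) = cinner x (A (tensor v))" if v: "v \<in> fock_words" for x v
  proof (induction x rule: fock_induct)
    case closed
    show ?case by (intro closed_Collect_eq continuous_intros bops_continuous[OF B(1)])
  next
    case (tensor w)
    then show ?case using T[OF v tensor] B(2) by (metis cinner_commute)
  qed (simp_all add: bopsD[OF B(1)] cinner_add_left cinner_scaleC_left)
  note 1 = this
  have "cinner (B x) y = cinner x (A y)" for x y
  proof (induction y rule: fock_induct)
    case closed
    show ?case by (intro closed_Collect_eq continuous_intros bops_continuous[OF A])
  qed (simp_all add: bopsD[OF A] cinner_add_right cinner_scaleC_right 1)
  then have adj: "is_adjoint B A" by (simp add: is_adjoint_def)
  show "hadj A \<in> bops" "is_adjoint (hadj A) A" "w \<in> fock_words \<Longrightarrow> hadj A (tensor w) = T w"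
    using B adj by (simp_all add: hadj_eqI[OF adj])
qed

section \<open>Left and right creation and annihilation operators\<close>

definition lcreate :: "(real \<Rightarrow> 'k::{real_inner,polish_space} \<times> 'k) \<Rightarrow> 'k fock \<Rightarrow> 'k fock" where
  "lcreate f = (THE A. A \<in> bops \<and> (\<forall>w\<in>fock_words. A (tensor w) = tensor (f # w)))"

text \<open>The mirror image of \<open>lcreate\<close>; for real functions it provides operators
  commuting with the semicircular generators.\<close>

definition rcreate :: "(real \<Rightarrow> 'k::{real_inner,polish_space} \<times> 'k) \<Rightarrow> 'k fock \<Rightarrow> 'k fock" where
  "rcreate f = (THE A. A \<in> bops \<and> (\<forall>w\<in>fock_words. A (tensor w) = tensor (w @ [f])))"

lemma the_bops:
  fixes A :: "'k::{real_inner,polish_space} fock \<Rightarrow> 'k fock"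
  assumes "\<exists>A\<in>bops. \<forall>w\<in>fock_words. A (tensor w) = T w"
  shows "(THE A. A \<in> bops \<and> (\<forall>w\<in>fock_words. A (tensor w) = T w)) \<in> bops \<and>
    (\<forall>w\<in>fock_words. (THE A. A \<in> bops \<and> (\<forall>w\<in>fock_words. A (tensor w) = T w)) (tensor w :: 'k fock) = T w)"
    (is "?F \<in> bops \<and> _")
proof -
  let ?P = "\<lambda>A::'k fock \<Rightarrow> 'k fock. A \<in> bops \<and> (\<forall>w\<in>fock_words. A (tensor w) = T w)"
  have "\<exists>!A. ?P A"
    using assms by (intro ex_ex1I) (auto intro!: bops_eqI)
  then show ?thesis by (rule theI')
qed

text \<open>Prefixing or appending \<open>f\<close> multiplies every inner product of words by
  \<open>L2_inner f f\<close>, as \<open>fock_operator_exists\<close> requires.\<close>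

lemma
  fixes f :: "real \<Rightarrow> 'k::{real_inner,polish_space} \<times> 'k"
  assumes f: "f \<in> L2"
  shows lcreate_bops: "lcreate f \<in> bops"
    and lcreate_tensor: "w \<in> fock_words \<Longrightarrow> lcreate f (tensor w) = tensor (f # w)"
    and rcreate_bops: "rcreate f \<in> bops"
    and rcreate_tensor: "w \<in> fock_words \<Longrightarrow> rcreate f (tensor w) = tensor (w @ [f])"
proof -
  have l: "\<exists>A\<in>bops. \<forall>w\<in>fock_words. A (tensor w) = tensor (f # w)"
    by (rule fock_operator_exists) (rule cinner_tensor_Cons[OF f f])
  show "lcreate f \<in> bops" "w \<in> fock_words \<Longrightarrow> lcreate f (tensor w) = tensor (f # w)"
    using the_bops[OF l] unfolding lcreate_def by blast+
  have r: "\<exists>A\<in>bops. \<forall>w\<in>fock_words. A (tensor w) = tensor (w @ [f])"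
    by (rule fock_operator_exists) (rule cinner_tensor_snoc[OF f f])
  show "rcreate f \<in> bops" "w \<in> fock_words \<Longrightarrow> rcreate f (tensor w) = tensor (w @ [f])"
    using the_bops[OF r] unfolding rcreate_def by blast+
qed

lemma
  fixes f :: "real \<Rightarrow> 'k::{real_inner,polish_space} \<times> 'k"
  assumes f: "f \<in> L2"
  shows lannihilate_bops: "hadj (lcreate f) \<in> bops"
    and lcreate_adjoint: "is_adjoint (hadj (lcreate f)) (lcreate f)"
    and lannihilate_vacuum: "hadj (lcreate f) \<Omega> = 0"
    and lannihilate_Cons: "g \<in> L2 \<Longrightarrow> w \<in> fock_words \<Longrightarrow>
      hadj (lcreate f) (tensor (g # w)) = L2_inner f g *\<^sub>C tensor w"
proof -
  \<comment> \<open>The value 0 on the empty word is forced: a word with prefix \<open>f\<close> is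
    never empty, and words of different lengths are orthogonal.\<close>
  define T :: "_ \<Rightarrow> 'k fock" where "T w = (case w of [] \<Rightarrow> 0 | g # w' \<Rightarrow> L2_inner f g *\<^sub>C tensor w')" for w
  have T: "cinner (tensor v) (T w) = cinner (lcreate f (tensor v)) (tensor w)"
    if "v \<in> fock_words" "w \<in> fock_words" for v w
    using that f
    by (cases w) (auto simp: T_def lcreate_tensor cinner_scaleC_right cinner_tensor_Cons
        cinner_tensor_length)
  note adj = fock_adjoint_exists[OF lcreate_bops[OF f] T]
  show "hadj (lcreate f) \<in> bops" "is_adjoint (hadj (lcreate f)) (lcreate f)"
    by (rule adj; assumption)+
  show "hadj (lcreate f) \<Omega> = 0"
    using adj(3)[of "[]"] by (simp add: T_def vacuum_def)
  show "g \<in> L2 \<Longrightarrow> w \<in> fock_words \<Longrightarrow>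
      hadj (lcreate f) (tensor (g # w)) = L2_inner f g *\<^sub>C tensor w"
    using adj(3)[of "g # w"] by (simp add: T_def)
qed

lemma
  fixes f :: "real \<Rightarrow> 'k::{real_inner,polish_space} \<times> 'k"
  assumes f: "f \<in> L2"
  shows rannihilate_bops: "hadj (rcreate f) \<in> bops"
    and rcreate_adjoint: "is_adjoint (hadj (rcreate f)) (rcreate f)"
    and rannihilate_vacuum: "hadj (rcreate f) \<Omega> = 0"
    and rannihilate_snoc: "g \<in> L2 \<Longrightarrow> w \<in> fock_words \<Longrightarrow>
      hadj (rcreate f) (tensor (w @ [g])) = L2_inner f g *\<^sub>C tensor w"
proof -
  \<comment> \<open>The same recipe at the other end of the word; the empty word is treated
    separately because it has no last letter.\<close>
  define T where "T w = (if w = [] then 0 else L2_inner f (last w) *\<^sub>C tensor (butlast w) :: 'k fock)" for w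
  have T: "cinner (tensor v) (T w) = cinner (rcreate f (tensor v)) (tensor w)"
    if "v \<in> fock_words" "w \<in> fock_words" for v w
    using that f
    by (cases w rule: rev_cases) (auto simp: T_def rcreate_tensor cinner_scaleC_right
        cinner_tensor_snoc cinner_tensor_length)
  note adj = fock_adjoint_exists[OF rcreate_bops[OF f] T]
  show "hadj (rcreate f) \<in> bops" "is_adjoint (hadj (rcreate f)) (rcreate f)"
    by (rule adj; assumption)+
  show "hadj (rcreate f) \<Omega> = 0"
    using adj(3)[of "[]"] by (simp add: T_def vacuum_def)
  show "g \<in> L2 \<Longrightarrow> w \<in> fock_words \<Longrightarrow>
      hadj (rcreate f) (tensor (w @ [g])) = L2_inner f g *\<^sub>C tensor w"
    using adj(3)[of "w @ [g]"] by (simp add: T_def)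
qed

text \<open>The rank one projection that measures the failure of left annihilation to commute with
  right creation.\<close>

definition vacuum_proj :: "'k::{real_inner,polish_space} fock \<Rightarrow> 'k fock" where
  "vacuum_proj x = cinner \<Omega> x *\<^sub>C \<Omega>"

lemma vacuum_proj_bops: "(vacuum_proj :: 'k::{real_inner,polish_space} fock \<Rightarrow> 'k fock) \<in> bops"
  unfolding bops_def
proof (intro CollectI conjI allI bounded_linear_intro)
  fix x y :: "'k fock" and r c
  show "vacuum_proj (x + y) = vacuum_proj x + vacuum_proj y"
    by (simp add: vacuum_proj_def cinner_add_right scaleC_add_left)
  show *: "vacuum_proj (c *\<^sub>C x) = c *\<^sub>C vacuum_proj x" for c
    by (simp add: vacuum_proj_def cinner_scaleC_right scaleC_scaleC)
  show "vacuum_proj (r *\<^sub>R x) = r *\<^sub>R vacuum_proj x"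
    by (simp add: scaleR_eq_scaleC *)
  have "cmod (cinner \<Omega> x) \<le> \<bar>\<Omega> \<bullet> x\<bar> + \<bar>\<Omega> \<bullet> ((- \<i>) *\<^sub>C x)\<bar>"
    using cmod_le[of "cinner \<Omega> x"] by (simp add: cinner_eq_Complex)
  also have "\<dots> \<le> norm (\<Omega> :: 'k fock) * norm x + norm (\<Omega> :: 'k fock) * norm ((- \<i>) *\<^sub>C x)"
    by (rule add_mono[OF Cauchy_Schwarz_ineq2 Cauchy_Schwarz_ineq2])
  finally have "cmod (cinner \<Omega> x) \<le> 2 * (norm (\<Omega> :: 'k fock) * norm x)"
    by (simp add: norm_scaleC)
  from mult_right_mono[OF this norm_ge_zero[of "\<Omega> :: 'k fock"]]
  show "norm (vacuum_proj x) \<le> norm x * (2 * norm (\<Omega> :: 'k fock) * norm (\<Omega> :: 'k fock))"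
    by (simp add: vacuum_proj_def norm_scaleC algebra_simps)
qed

lemma vacuum_proj_vacuum: "vacuum_proj \<Omega> = \<Omega>"
  by (simp add: vacuum_proj_def cinner_vacuum)

lemma vacuum_proj_tensor: "w \<in> fock_words \<Longrightarrow> w \<noteq> [] \<Longrightarrow> vacuum_proj (tensor w) = 0"
  by (simp add: vacuum_proj_def vacuum_def cinner_tensor_length)

section \<open>Relations between left and right operators\<close>

context
  fixes f g :: "real \<Rightarrow> 'k::{real_inner,polish_space} \<times> 'k"
  assumes fg: "f \<in> L2" "g \<in> L2"
begin

lemma lannihilate_lcreate: "hadj (lcreate f) (lcreate g x) = L2_inner f g *\<^sub>C x"
proof -
  have "hadj (lcreate f) \<circ> lcreate g = (\<lambda>x. L2_inner f g *\<^sub>C x)"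
    by (rule bops_eqI) (use fg in \<open>auto intro!: bops_comp lannihilate_bops lcreate_bops bops_scaleC
        simp: lcreate_tensor lannihilate_Cons\<close>)
  from fun_cong[OF this, of x] show ?thesis by simp
qed

lemma rannihilate_rcreate: "hadj (rcreate f) (rcreate g x) = L2_inner f g *\<^sub>C x"
proof -
  have "hadj (rcreate f) \<circ> rcreate g = (\<lambda>x. L2_inner f g *\<^sub>C x)"
    by (rule bops_eqI) (use fg in \<open>auto intro!: bops_comp rannihilate_bops rcreate_bops bops_scaleC
        simp: rcreate_tensor rannihilate_snoc\<close>)
  from fun_cong[OF this, of x] show ?thesis by simp
qed

lemma lcreate_rcreate: "lcreate f (rcreate g x) = rcreate g (lcreate f x)"
proof -
  have "lcreate f \<circ> rcreate g = rcreate g \<circ> lcreate f"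
    by (rule bops_eqI) (use fg in \<open>auto intro!: bops_comp rcreate_bops lcreate_bops
        simp: lcreate_tensor rcreate_tensor\<close>)
  from fun_cong[OF this, of x] show ?thesis by simp
qed

text \<open>On a nonempty word the two operators act at opposite ends and commute. On the vacuum the
  appended letter is also the first one, which leaves the scalar
  \<open>L2_inner f g\<close>.\<close>

lemma lannihilate_rcreate:
  "hadj (lcreate f) (rcreate g x) = rcreate g (hadj (lcreate f) x) + L2_inner f g *\<^sub>C vacuum_proj x"
proof -
  have "hadj (lcreate f) \<circ> rcreate g
      = (\<lambda>x. (rcreate g \<circ> hadj (lcreate f)) x + ((\<lambda>x. L2_inner f g *\<^sub>C x) \<circ> vacuum_proj) x)"
  proof (rule bops_eqI)
    show "hadj (lcreate f) \<circ> rcreate g \<in> bops"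
      by (intro bops_comp lannihilate_bops rcreate_bops fg)
    show "(\<lambda>x. (rcreate g \<circ> hadj (lcreate f)) x + ((\<lambda>x. L2_inner f g *\<^sub>C x) \<circ> vacuum_proj) x) \<in> bops"
      by (intro bops_add bops_comp lannihilate_bops rcreate_bops fg bops_scaleC vacuum_proj_bops)
    fix w :: "(real \<Rightarrow> 'k \<times> 'k) list" assume w: "w \<in> fock_words"
    show "(hadj (lcreate f) \<circ> rcreate g) (tensor w)
      = (rcreate g \<circ> hadj (lcreate f)) (tensor w) + ((\<lambda>x. L2_inner f g *\<^sub>C x) \<circ> vacuum_proj) (tensor w)"
    proof (cases w)
      case Nil
      then show ?thesis
        using fg by (simp add: rcreate_tensor lannihilate_Cons lannihilate_vacuum[unfolded vacuum_def]
            bopsD[OF rcreate_bops] vacuum_proj_vacuum[unfolded vacuum_def])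
    next
      case (Cons h v)
      then show ?thesis
        using fg w by (simp add: rcreate_tensor lannihilate_Cons vacuum_proj_tensor bopsD[OF rcreate_bops])
    qed
  qed
  from fun_cong[OF this, of x] show ?thesis by simp
qed

text \<open>This is the adjoint of \<open>lannihilate_rcreate\<close>; the vacuum projection is
  self-adjoint and the coefficient gets conjugated.\<close>

lemma rannihilate_lcreate:
  "hadj (rcreate g) (lcreate f x) = lcreate f (hadj (rcreate g) x) + L2_inner g f *\<^sub>C vacuum_proj x"
proof (rule cinner_ext)
  fix y :: "'k fock"
  note adj = lcreate_adjoint[OF fg(1), unfolded is_adjoint_def, rule_format]
    rcreate_adjoint[OF fg(2), unfolded is_adjoint_def, rule_format]
  have P: "cinner (vacuum_proj y) x = cinner y (vacuum_proj x)"
    by (simp add: vacuum_proj_def cinner_scaleC_left cinner_scaleC_right mult.commute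
        cinner_commute[of y "\<Omega>"])
  have "cinner y (hadj (rcreate g) (lcreate f x)) = cinner (hadj (lcreate f) (rcreate g y)) x"
    by (simp add: is_adjoint_right[OF rcreate_adjoint[OF fg(2)]] adj)
  also have "\<dots> = cinner y (lcreate f (hadj (rcreate g) x) + L2_inner g f *\<^sub>C vacuum_proj x)"
    unfolding lannihilate_rcreate
    by (simp add: cinner_add_left cinner_add_right cinner_scaleC_left cinner_scaleC_right P
        is_adjoint_right[OF rcreate_adjoint[OF fg(2)], symmetric] adj(1) L2_inner_herm[of g f])
  finally show "cinner y (hadj (rcreate g) (lcreate f x))
    = cinner y (lcreate f (hadj (rcreate g) x) + L2_inner g f *\<^sub>C vacuum_proj x)" .
qed

lemma lannihilate_rannihilate:
  "hadj (lcreate f) (hadj (rcreate g) x) = hadj (rcreate g) (hadj (lcreate f) x)"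
  by (rule cinner_ext)
    (simp add: is_adjoint_right[OF rcreate_adjoint[OF fg(2)]] is_adjoint_right[OF lcreate_adjoint[OF fg(1)]]
      lcreate_rcreate)

end


section \<open>Relative commutants in the free group factor\<close>

definition real_part_embed :: "(real \<Rightarrow> 'k::real_vector) \<Rightarrow> real \<Rightarrow> 'k \<times> 'k" where
  "real_part_embed f = (\<lambda>x. (f x, 0))"

lemma creation_eq_lcreate: "creation f = lcreate (real_part_embed f)"
  by (simp add: creation_def lcreate_def real_part_embed_def)

definition rsemicircular :: "(real \<Rightarrow> 'k::{real_inner,polish_space}) \<Rightarrow> 'k fock \<Rightarrow> 'k fock" where
  "rsemicircular f = (\<lambda>\<xi>. (rcreate (real_part_embed f) \<xi> + hadj (rcreate (real_part_embed f)) \<xi>) /\<^sub>R 2)"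

lemma real_part_embed_L2:
  fixes f :: "real \<Rightarrow> 'k::{real_inner,polish_space}"
  assumes "f \<in> L2" shows "real_part_embed f \<in> L2"
proof -
  have "(\<lambda>x. (f x, 0::'k)) \<in> borel_measurable halfline"
    using assms unfolding L2_def by (intro borel_measurable_Pair) auto
  then show ?thesis
    using assms by (simp add: L2_def real_part_embed_def norm_prod_def)
qed

lemma L2_inner_real_part_embed:
  "L2_inner (real_part_embed f) (real_part_embed g) = L2_inner (real_part_embed g) (real_part_embed f)"
  by (simp add: L2_inner_def cplx_inner_def real_part_embed_def inner_commute)

lemma semicircular_bops: "f \<in> L2 \<Longrightarrow> semicircular f \<in> bops"
  unfolding semicircular_def creation_eq_lcreate
  by (intro bops_scaleR bops_add lcreate_bops lannihilate_bops real_part_embed_L2)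

lemma rsemicircular_bops: "f \<in> L2 \<Longrightarrow> rsemicircular f \<in> bops"
  unfolding rsemicircular_def
  by (intro bops_scaleR bops_add rcreate_bops rannihilate_bops real_part_embed_L2)

text \<open>Creations commute with each other, and so do annihilations. The mixed terms contribute
  vacuum projections with coefficients \<open>L2_inner f g\<close> and \<open>L2_inner g f\<close>;
  these cancel in the commutator because inner products of real functions are symmetric.\<close>

lemma rsemicircular_semicircular_commute:
  fixes f g :: "real \<Rightarrow> 'k::{real_inner,polish_space}"
  assumes "f \<in> L2" "g \<in> L2"
  shows "rsemicircular g \<circ> semicircular f = semicircular f \<circ> rsemicircular g"
proof
  fix x
  let ?f = "real_part_embed f" and ?g = "real_part_embed g"
  have fg: "?f \<in> L2" "?g \<in> L2" using assms by (simp_all add: real_part_embed_L2)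
  note lin = bopsD[OF lcreate_bops[OF fg(1)]] bopsD[OF lannihilate_bops[OF fg(1)]]
    bopsD[OF rcreate_bops[OF fg(2)]] bopsD[OF rannihilate_bops[OF fg(2)]]
  show "(rsemicircular g \<circ> semicircular f) x = (semicircular f \<circ> rsemicircular g) x"
    unfolding semicircular_def rsemicircular_def creation_eq_lcreate comp_apply
    by (simp add: lin lcreate_rcreate[OF fg] lannihilate_rcreate[OF fg] rannihilate_lcreate[OF fg]
        lannihilate_rannihilate[OF fg] L2_inner_real_part_embed[of g f] scaleR_add_right add_ac)
qed

lemma rsemicircular_in_commutant:
  "g \<in> L2 \<Longrightarrow> rsemicircular g \<in> commutant (semicircular ` L2)"
  unfolding commutant_def using rsemicircular_bops rsemicircular_semicircular_commute by blast

lemma semicircular_in_free_algebra: "f \<in> L2 \<Longrightarrow> semicircular f \<in> free_algebra"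
  unfolding free_algebra_def
  by (auto simp: commutant_def[of "commutant _"] semicircular_bops) (auto simp: commutant_def)

lemma free_algebra_bops: "x \<in> free_algebra \<Longrightarrow> x \<in> bops"
  by (simp add: free_algebra_def commutant_def)

lemma id_in_free_algebra: "id \<in> free_algebra"
  by (auto simp: free_algebra_def commutant_def bops_id)

lemma free_algebra_commute_rsemicircular:
  assumes "x \<in> free_algebra" "g \<in> L2"
  shows "x (rsemicircular g \<xi>) = rsemicircular g (x \<xi>)"
proof -
  have "x \<circ> rsemicircular g = rsemicircular g \<circ> x"
    using assms rsemicircular_in_commutant unfolding free_algebra_def commutant_def[of "commutant _"]
    by blast
  from fun_cong[OF this, of \<xi>] show ?thesis by simp
qed

text \<open>Right semicircular operators take real functions while letters of words are
  complexified, so the last letter is split into real and imaginary parts.\<close>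

lemma tensor_snoc_split:
  fixes f :: "real \<Rightarrow> 'k::{real_inner,polish_space} \<times> 'k"
  assumes f: "f \<in> L2" and w: "w \<in> fock_words"
  obtains g h where "g \<in> L2" "h \<in> L2"
    "tensor (w @ [f]) = tensor (w @ [real_part_embed g]) + \<i> *\<^sub>C tensor (w @ [real_part_embed h])"
proof
  define g h where "g x = fst (f x)" and "h x = snd (f x)" for x
  have f': "f \<in> borel_measurable halfline" "integrable halfline (\<lambda>x. (norm (f x))\<^sup>2)"
    using f by (auto simp: L2_def)
  have m: "g \<in> borel_measurable halfline" "h \<in> borel_measurable halfline"
    unfolding g_def h_def
    by (auto intro: borel_measurable_continuous_on[OF continuous_on_fst[OF continuous_on_id] f'(1)]
        borel_measurable_continuous_on[OF continuous_on_snd[OF continuous_on_id] f'(1)])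
  have n: "(norm (f x))\<^sup>2 = (norm (g x))\<^sup>2 + (norm (h x))\<^sup>2" for x
    by (simp add: g_def h_def norm_prod_def)
  have sq: "(\<lambda>x. (norm (g x))\<^sup>2) \<in> borel_measurable halfline"
    "(\<lambda>x. (norm (h x))\<^sup>2) \<in> borel_measurable halfline"
    using m by measurable
  have "integrable halfline (\<lambda>x. (norm (g x))\<^sup>2)"
    by (rule Bochner_Integration.integrable_bound[OF f'(2) sq(1)]) (simp add: n)
  then show g: "g \<in> L2" using m by (simp add: L2_def)
  have "integrable halfline (\<lambda>x. (norm (h x))\<^sup>2)"
    by (rule Bochner_Integration.integrable_bound[OF f'(2) sq(2)]) (simp add: n)
  then show h: "h \<in> L2" using m by (simp add: L2_def)
  \<comment> \<open>Words are not additive in their letters, only their classes are; the identity is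
    therefore tested through inner products.\<close>
  have split: "L2_inner u f = L2_inner u (real_part_embed g) + \<i> * L2_inner u (real_part_embed h)"
    if u: "u \<in> L2" for u
  proof -
    note int = integrable_cplx_inner[OF u real_part_embed_L2]
    have "L2_inner u f = (\<integral>x. cplx_inner (u x) (real_part_embed g x)
        + \<i> * cplx_inner (u x) (real_part_embed h x) \<partial>halfline)"
      unfolding L2_inner_def
      by (intro Bochner_Integration.integral_cong refl)
        (simp add: cplx_inner_def real_part_embed_def g_def h_def complex_eq_iff)
    also have "\<dots> = L2_inner u (real_part_embed g) + \<i> * L2_inner u (real_part_embed h)"
      unfolding L2_inner_def using int[OF g] int[OF h] by simp
    finally show ?thesis .
  qed
  show "tensor (w @ [f]) = tensor (w @ [real_part_embed g]) + \<i> *\<^sub>C tensor (w @ [real_part_embed h])"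
  proof (rule cinner_ext)
    fix y
    show "cinner y (tensor (w @ [f]))
      = cinner y (tensor (w @ [real_part_embed g]) + \<i> *\<^sub>C tensor (w @ [real_part_embed h]))"
    proof (induction y rule: fock_induct)
      case closed
      show ?case by (intro closed_Collect_eq continuous_intros)
    next
      case (tensor v)
      note L = f real_part_embed_L2[OF g] real_part_embed_L2[OF h]
      show ?case
      proof (cases v rule: rev_cases)
        case Nil
        then show ?thesis using L w by (simp add: cinner_tensor_length cinner_add_right cinner_scaleC_right)
      next
        case (snoc v' u)
        then show ?thesis
          using L w tensor
          by (simp add: cinner_add_right cinner_scaleC_right cinner_tensor_snoc split distrib_right)
      qed
    qed (simp_all add: cinner_add_left cinner_scaleC_left distrib_left[symmetric] )
  qed
qed

text \<open>The vacuum is cyclic for the right semicircular operators.\<close>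

lemma commute_rsemicircular_imp_scalar:
  fixes x :: "'k::{real_inner,polish_space} fock \<Rightarrow> 'k fock"
  assumes x: "x \<in> bops" and comm: "\<And>g \<xi>. g \<in> L2 \<Longrightarrow> x (rsemicircular g \<xi>) = rsemicircular g (x \<xi>)"
    and vac: "x \<Omega> = c *\<^sub>C \<Omega>"
  shows "x = (\<lambda>\<xi>. c *\<^sub>C \<xi>)"
proof (rule bops_eqI[OF x bops_scaleC])
  fix w :: "(real \<Rightarrow> 'k \<times> 'k) list" assume "w \<in> fock_words"
  then show "x (tensor w) = c *\<^sub>C tensor w"
  \<comment> \<open>Induction on the length, since annihilation leads to a word shorter by two
    letters.\<close>
  proof (induction "length w" arbitrary: w rule: less_induct)
    case less
    show ?case
    proof (cases w rule: rev_cases)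
      case Nil
      then show ?thesis using vac by (simp add: vacuum_def)
    next
      case (snoc v f)
      then have v: "v \<in> fock_words" and f: "f \<in> L2" using less.prems by auto
      have real: "x (tensor (v @ [real_part_embed g])) = c *\<^sub>C tensor (v @ [real_part_embed g])"
        if g: "g \<in> L2" for g
      proof -
        let ?g = "real_part_embed g"
        note G = real_part_embed_L2[OF g]
        have ann: "x (hadj (rcreate ?g) (tensor v)) = c *\<^sub>C hadj (rcreate ?g) (tensor v)"
        proof (cases v rule: rev_cases)
          case Nil
          then show ?thesis
            using rannihilate_vacuum[OF G] by (simp add: vacuum_def bopsD[OF x])
        next
          case (snoc v' u)
          then have "x (tensor v') = c *\<^sub>C tensor v'"
            using v \<open>w = v @ [f]\<close> by (intro less.hyps) auto
          then show ?thesis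
            using v G snoc by (simp add: rannihilate_snoc bopsD[OF x] scaleC_left_commute)
        qed
        \<comment> \<open>Appending a letter is a right semicircular operator, which commutes with
          \<open>x\<close>, up to an annihilation term settled by induction.\<close>
        have "tensor (v @ [?g]) = 2 *\<^sub>R rsemicircular g (tensor v) - hadj (rcreate ?g) (tensor v)"
          using rcreate_tensor[OF G v] by (simp add: rsemicircular_def)
        moreover have "x (tensor v) = c *\<^sub>C tensor v"
          using v snoc by (intro less.hyps) auto
        ultimately show ?thesis
          by (simp add: bopsD[OF x] comm[OF g] ann bopsD[OF rsemicircular_bops[OF g]]
              scaleC_diff_right scaleR_eq_scaleC scaleC_left_commute)
      qed
      obtain g h where gh: "g \<in> L2" "h \<in> L2"
        "tensor (v @ [f]) = tensor (v @ [real_part_embed g]) + \<i> *\<^sub>C tensor (v @ [real_part_embed h])"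
        using tensor_snoc_split[OF f v] .
      show ?thesis
        using snoc by (simp add: gh(3) bopsD[OF x] real[OF gh(1)] real[OF gh(2)] scaleC_add_right
            scaleC_left_commute)
    qed
  qed
qed

text \<open>Commutation along a single infinite orthonormal sequence suffices: Bessel's inequality
  drives both annihilation terms to 0, while the norm identity relates them to a fixed
  vector.\<close>

lemma relative_commutant_scalar:
  fixes x :: "'k::{real_inner,polish_space} fock \<Rightarrow> 'k fock"
  assumes x: "x \<in> free_algebra"
    and h: "\<And>n. h n \<in> L2"
    and orth: "\<And>m n. L2_inner (real_part_embed (h m)) (real_part_embed (h n)) = (if m = n then 1 else 0)"
    and comm: "\<And>(n::nat). x \<circ> semicircular (h n) = semicircular (h n) \<circ> x"
  obtains c where "x = (\<lambda>\<xi>. c *\<^sub>C \<xi>)"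
proof -
  let ?h = "\<lambda>n. real_part_embed (h n)"
  note H = real_part_embed_L2[OF h]
  define c where "c = cinner \<Omega> (x \<Omega>)"
  define \<xi> where "\<xi> = x \<Omega> - c *\<^sub>C \<Omega>"
  let ?l = "\<lambda>n. lcreate (?h n)" and ?r = "\<lambda>n. rcreate (?h n)"
  \<comment> \<open>A one-letter word has the same first and last letter, and annihilation kills the
    vacuum.\<close>
  have vac: "semicircular (h n) \<Omega> = rsemicircular (h n) \<Omega>" for n
    using lcreate_tensor[OF H, of "[]" n] rcreate_tensor[OF H, of "[]" n]
    by (simp add: semicircular_def rsemicircular_def creation_eq_lcreate lannihilate_vacuum[OF H]
        rannihilate_vacuum[OF H] vacuum_def[symmetric])
  \<comment> \<open>Both sides equal \<open>x\<close> applied to the common vector of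
    \<open>vac\<close>: on the left by \<open>comm\<close>, on the right because \<open>x\<close>
    commutes with right semicircular operators.\<close>
  have "semicircular (h n) (x \<Omega>) = rsemicircular (h n) (x \<Omega>)" for n
    using fun_cong[OF comm, of n \<Omega>] free_algebra_commute_rsemicircular[OF x h] by (simp add: vac)
  then have "semicircular (h n) \<xi> = rsemicircular (h n) \<xi>" for n
    by (simp add: \<xi>_def bopsD[OF semicircular_bops[OF h]] bopsD[OF rsemicircular_bops[OF h]] vac)
  \<comment> \<open>Creations and annihilations are separated so that the norms of the two sides can
    be compared.\<close>
  then have eq: "?l n \<xi> - ?r n \<xi> = hadj (?r n) \<xi> - hadj (?l n) \<xi>" for n
    by (simp add: semicircular_def rsemicircular_def creation_eq_lcreate) (simp add: algebra_simps)
  have "cinner \<Omega> \<xi> = 0"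
    by (simp add: \<xi>_def cinner_diff_right cinner_scaleC_right cinner_vacuum c_def)
  then have P: "vacuum_proj \<xi> = 0" by (simp add: vacuum_proj_def)
  have norm_eq: "2 * (norm \<xi>)\<^sup>2 = (norm (hadj (?l n) \<xi>))\<^sup>2 + (norm (hadj (?r n) \<xi>))\<^sup>2" for n
  proof -
    note adj = lcreate_adjoint[OF H, of n, unfolded is_adjoint_def, rule_format]
      rcreate_adjoint[OF H, of n, unfolded is_adjoint_def, rule_format]
    have ll: "cinner (?l n \<xi>) (?l n \<xi>) = cinner \<xi> \<xi>" "cinner (?r n \<xi>) (?r n \<xi>) = cinner \<xi> \<xi>"
      using is_adjoint_right[OF lcreate_adjoint[OF H], of \<xi> n "?l n \<xi>"]
        is_adjoint_right[OF rcreate_adjoint[OF H], of \<xi> n "?r n \<xi>"]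
      by (simp_all add: lannihilate_lcreate[OF H H] rannihilate_rcreate[OF H H] orth)
    \<comment> \<open>The vacuum term vanishes as \<xi> is orthogonal to \<Omega>; the cross terms
      in the two squared norms thus agree and cancel.\<close>
    have lr: "cinner (?l n \<xi>) (?r n \<xi>) = cinner (hadj (?r n) \<xi>) (hadj (?l n) \<xi>)"
      using is_adjoint_right[OF lcreate_adjoint[OF H], of \<xi> n "?r n \<xi>"]
      by (simp add: lannihilate_rcreate[OF H H] P adj(2))
    have "(norm (?l n \<xi> - ?r n \<xi>))\<^sup>2 = 2 * (norm \<xi>)\<^sup>2 - 2 * Re (cinner (?l n \<xi>) (?r n \<xi>))"
      using arg_cong[OF ll(1), of Re] arg_cong[OF ll(2), of Re]
      by (simp add: power2_norm_eq_inner inner_diff_left inner_diff_right inner_eq_Re_cinner[symmetric]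
          inner_commute)
    moreover have "(norm (hadj (?r n) \<xi> - hadj (?l n) \<xi>))\<^sup>2 = (norm (hadj (?l n) \<xi>))\<^sup>2
        + (norm (hadj (?r n) \<xi>))\<^sup>2 - 2 * Re (cinner (hadj (?r n) \<xi>) (hadj (?l n) \<xi>))"
      by (simp add: power2_norm_eq_inner inner_diff_left inner_diff_right inner_eq_Re_cinner[symmetric]
          inner_commute)
    ultimately show ?thesis using eq[of n] lr by simp
  qed
  have "(\<lambda>n. hadj (?l n) \<xi>) \<longlonglongrightarrow> 0"
    by (rule adjoint_orthogonal_isometries_tendsto_0[where A = ?l])
      (simp_all add: lcreate_adjoint[OF H] lannihilate_lcreate[OF H H] orth)
  moreover have "(\<lambda>n. hadj (?r n) \<xi>) \<longlonglongrightarrow> 0"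
    by (rule adjoint_orthogonal_isometries_tendsto_0[where A = ?r])
      (simp_all add: rcreate_adjoint[OF H] rannihilate_rcreate[OF H H] orth)
  ultimately have "(\<lambda>n. (norm (hadj (?l n) \<xi>))\<^sup>2 + (norm (hadj (?r n) \<xi>))\<^sup>2) \<longlonglongrightarrow> (norm (0::'k fock))\<^sup>2 + (norm (0::'k fock))\<^sup>2"
    by (intro tendsto_intros)
  then have "(\<lambda>n::nat. 2 * (norm \<xi>)\<^sup>2) \<longlonglongrightarrow> 0" by (simp add: norm_eq[symmetric])
  then have "\<xi> = 0" by (simp add: LIMSEQ_const_iff)
  then have "x \<Omega> = c *\<^sub>C \<Omega>" by (simp add: \<xi>_def)
  then show thesis
    using that commute_rsemicircular_imp_scalar[OF free_algebra_bops[OF x]]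
      free_algebra_commute_rsemicircular[OF x] by blast
qed


section \<open>Gauge cocycles of the free flow\<close>

definition unit_block :: "'k::real_vector \<Rightarrow> nat \<Rightarrow> real \<Rightarrow> 'k" where
  "unit_block v n = (\<lambda>s. indicator {real n..<real n + 1} s *\<^sub>R v)"

lemma right_shift_unit_block:
  "0 \<le> t \<Longrightarrow> right_shift t (unit_block v n) = (\<lambda>s. indicator {real n + t..<real n + 1 + t} s *\<^sub>R v)"
  by (intro ext) (auto simp: right_shift_def unit_block_def indicator_def)

lemma indicator_scaleR_L2:
  fixes v :: "'k::{real_inner,polish_space}" and a b :: real
  assumes "0 \<le> a"
  shows "(\<lambda>s. indicator {a..<b} s *\<^sub>R v) \<in> L2"
proof -
  have "(\<lambda>s. indicator {a..<b} s *\<^sub>R v) \<in> borel_measurable halfline"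
    unfolding halfline_def by (intro measurable_restrict_space1) measurable
  \<comment> \<open>As \<open>0 \<le> a\<close>, the interval lies inside the half-line and
    restricting the measure leaves the integrand unchanged.\<close>
  moreover have "(\<lambda>s. indicator {0..} s *\<^sub>R (norm (indicator {a..<b} s *\<^sub>R v))\<^sup>2)
      = (\<lambda>s. indicator {a..<b} s * (norm v)\<^sup>2)"
    using assms by (auto simp: indicator_def)
  then have "integrable halfline (\<lambda>s. (norm (indicator {a..<b} s *\<^sub>R v))\<^sup>2)"
    unfolding halfline_def
    by (subst integrable_restrict_space)
      (simp_all only:, auto intro!: integrable_mult_left integrable_real_indicator emeasure_bounded_finite)
  ultimately show ?thesis by (simp add: L2_def)
qed

lemma unit_block_L2:
  fixes v :: "'k::{real_inner,polish_space}"
  shows "unit_block v n \<in> L2"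
  unfolding unit_block_def by (rule indicator_scaleR_L2) simp

lemma right_shift_unit_block_L2:
  fixes v :: "'k::{real_inner,polish_space}"
  shows "0 \<le> t \<Longrightarrow> right_shift t (unit_block v n) \<in> L2"
  by (simp add: right_shift_unit_block indicator_scaleR_L2)

lemma right_shift_unit_block_orthonormal:
  fixes v :: "'k::{real_inner,polish_space}"
  assumes v: "norm v = 1" and t: "0 \<le> t"
  shows "L2_inner (real_part_embed (right_shift t (unit_block v m)))
    (real_part_embed (right_shift t (unit_block v n))) = (if m = n then 1 else 0)"
proof -
  let ?I = "\<lambda>n s. indicator {real n + t..<real n + 1 + t} s :: real"
  have "v \<bullet> v = 1" using v by (simp add: norm_eq_1)
  have disj: "?I m s * ?I n s = (if m = n then ?I m s else 0)" for s
  proof (cases "m = n")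
    case False
    \<comment> \<open>Distinct naturals differ by at least 1, so the half-open unit intervals are
      disjoint.\<close>
    then have "real m + 1 \<le> real n \<or> real n + 1 \<le> real m" by linarith
    then show ?thesis using False by (auto simp: indicator_def)
  qed (simp add: indicator_def)
  have *: "cplx_inner (real_part_embed (right_shift t (unit_block v m)) s)
      (real_part_embed (right_shift t (unit_block v n)) s)
    = complex_of_real (if m = n then ?I m s else 0)" for s
    using t \<open>v \<bullet> v = 1\<close> disj[of s]
    by (cases "m = n")
      (auto simp: right_shift_unit_block cplx_inner_def real_part_embed_def complex_eq_iff)
  have "(\<lambda>s. indicator {0..} s *\<^sub>R ?I m s) = ?I m"
    using t by (intro ext) (auto simp: indicator_def)
  then have "(\<integral>s. ?I m s \<partial>halfline) = (\<integral>s. ?I m s \<partial>lborel)"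
    unfolding halfline_def by (subst integral_restrict_space) simp_all
  also have "\<dots> = 1" by simp
  finally have "(\<integral>s. ?I m s \<partial>halfline) = 1" .
  then show ?thesis
    unfolding L2_inner_def * integral_complex_of_real by (cases "m = n") simp_all
qed

text \<open>Continuity is upgraded to differentiability by integration: the primitive
  \<open>F\<close> is differentiable, and \<open>c\<close> turns out to be an affine function of
  \<open>F\<close>, so that it solves a linear differential equation.\<close>

lemma continuous_character_exp:
  fixes c :: "real \<Rightarrow> complex"
  assumes cont: "continuous_on {0..} c"
    and mult: "\<And>s t. 0 \<le> s \<Longrightarrow> 0 \<le> t \<Longrightarrow> c (s + t) = c s * c t"
    and "c 0 \<noteq> 0"
  obtains \<kappa> where "\<And>t. 0 \<le> t \<Longrightarrow> c t = exp (\<kappa> * of_real t)"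
proof -
  have c0: "c 0 = 1" using mult[of 0 0] \<open>c 0 \<noteq> 0\<close> by simp
  have cont': "continuous_on {a..b} c" if "0 \<le> a" for a b
    by (rule continuous_on_subset[OF cont]) (use that in auto)
  define F where "F t = integral {0..t} c" for t
  have F_add: "F (s + t) = F s + c s * F t" if "0 \<le> s" "0 \<le> t" for s t
  proof -
    have "F (s + t) = integral {0..s} c + integral {s..s + t} c"
      unfolding F_def using that
      by (intro Henstock_Kurzweil_Integration.integral_combine[symmetric] integrable_continuous_real cont') auto
    also have "integral {s..s + t} c = integral {0..t} (c \<circ> (\<lambda>x. x + s))"
      using integral_shift[of 0 s t c] cont'[of s "s + t"] that by (simp add: add.commute)
    also have "\<dots> = integral {0..t} (\<lambda>x. c s * c x)"
      using that mult[of s] by (intro Henstock_Kurzweil_Integration.integral_cong) (simp add: add.commute)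
    finally show ?thesis by (simp add: F_def)
  qed
  have dF: "(F has_vector_derivative c t) (at t within {0..b})" if "t \<in> {0..b}" for t b
    unfolding F_def using that by (intro integral_has_vector_derivative cont') auto
  \<comment> \<open>If \<open>F\<close> vanished throughout, so would its derivative
    \<open>c 0 = 1\<close> at 0.\<close>
  have "\<exists>a\<ge>0. F a \<noteq> 0"
  proof (rule ccontr)
    assume "\<not> ?thesis"
    then have F0: "F t = 0" if "t \<in> {0..1}" for t using that by auto
    have "((\<lambda>_. 0) has_vector_derivative c 0) (at 0 within {0..1})"
    proof (rule has_vector_derivative_transform)
      show "(F has_vector_derivative c 0) (at 0 within {0..1})" by (rule dF) simp
    qed (simp_all add: F0)
    then have "c 0 = 0"
      using vector_derivative_unique_within_closed_interval[of 0 1 0 "\<lambda>_. 0" "c 0" 0] by simp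
    then show False using c0 by simp
  qed
  then obtain a where a: "a \<ge> 0" "F a \<noteq> 0" by blast
  \<comment> \<open>Found by expanding \<open>F (a + t) = F (t + a)\<close> in both orders with
    \<open>F_add\<close> and solving for \<open>c t\<close>.\<close>
  define \<kappa> where "\<kappa> = (c a - 1) / F a"
  have cF: "c t = 1 + \<kappa> * F t" if "t \<ge> 0" for t
    using F_add[of a t] F_add[of t a] that a by (simp add: \<kappa>_def add.commute field_simps)
  have "c b = exp (\<kappa> * of_real b)" if b: "0 \<le> b" for b
  proof -
    \<comment> \<open>The integrating factor: its product with \<open>c\<close> has derivative
      0.\<close>
    let ?E = "\<lambda>t. exp (- \<kappa> * of_real t)"
    have dc: "(c has_vector_derivative \<kappa> * c t) (at t within {0..b})" if t: "t \<in> {0..b}" for t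
    proof (rule has_vector_derivative_transform[OF t])
      show "((\<lambda>t. 1 + \<kappa> * F t) has_vector_derivative \<kappa> * c t) (at t within {0..b})"
        using dF[OF t] by (auto intro!: derivative_eq_intros)
    qed (simp add: cF)
    have dE: "(?E has_vector_derivative - \<kappa> * ?E t) (at t within {0..b})" for t
      by (rule has_vector_derivative_real_field) (auto intro!: derivative_eq_intros)
    have "((\<lambda>t. c t * ?E t) has_vector_derivative 0) (at t within {0..b})" if t: "t \<in> {0..b}" for t
      using has_vector_derivative_mult[OF dc[OF t] dE[of t]] by (simp add: algebra_simps)
    then obtain d where "\<And>t. t \<in> {0..b} \<Longrightarrow> c t * ?E t = d"
      using has_vector_derivative_zero_constant[of "{0..b}" "\<lambda>t. c t * ?E t"] by auto
    from this[of b] this[of 0] have "c b * ?E b = 1" using b c0 by simp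
    then show ?thesis by (simp add: exp_minus field_simps)
  qed
  then show thesis by (rule that)
qed

lemma exp_eq_on_halfline_imp_eq:
  fixes c d :: complex
  assumes "\<And>t. 0 \<le> t \<Longrightarrow> exp (c * of_real t) = exp (d * of_real t)"
  shows "c = d"
proof -
  \<comment> \<open>Chosen so small that the imaginary parts of the exponents differ by less than 1,
    where \<open>exp\<close> is injective.\<close>
  define t where "t = 1 / (1 + \<bar>Im c - Im d\<bar>)"
  have t: "t > 0" by (simp add: t_def add_pos_nonneg)
  have "\<bar>Im c - Im d\<bar> * t < 1"
    by (simp add: t_def add_pos_nonneg)
  then have "\<bar>Im c * t - Im d * t\<bar> < 1"
    using t by (simp add: abs_mult left_diff_distrib[symmetric])
  then have "\<bar>Im (c * of_real t) - Im (d * of_real t)\<bar> < 2 * pi"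
    using pi_gt3 by simp
  then have "c * of_real t = d * of_real t"
    by (rule exp_complex_eqI) (rule assms[OF less_imp_le[OF t]])
  then show ?thesis using t by simp
qed

lemma scaleC_fun_eq_iff:
  "(\<lambda>\<xi>. c *\<^sub>C \<xi> :: 'k::{real_inner,polish_space} fock) = (\<lambda>\<xi>. d *\<^sub>C \<xi>) \<longleftrightarrow> c = d"
proof
  assume "(\<lambda>\<xi>. c *\<^sub>C \<xi> :: 'k fock) = (\<lambda>\<xi>. d *\<^sub>C \<xi>)"
  from fun_cong[OF this, of \<Omega>]
  have "cinner \<Omega> (c *\<^sub>C \<Omega> :: 'k fock) = cinner \<Omega> (d *\<^sub>C \<Omega> :: 'k fock)" by simp
  then show "c = d" by (simp add: cinner_scaleC_right cinner_vacuum)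
qed simp

text \<open>At each time the shifted blocks form an orthonormal sequence whose semicircular
  operators lie in the range of the flow, so \<open>relative_commutant_scalar\<close> applies and
  leaves a scalar character.\<close>

lemma gauge_cocycle_free_flow:
  fixes \<gamma> :: "real \<Rightarrow> ('k::{real_inner,polish_space} fock \<Rightarrow> 'k fock) \<Rightarrow> ('k fock \<Rightarrow> 'k fock)"
    and v :: 'k
  assumes v: "norm v = 1" and \<gamma>: "is_free_flow \<gamma>" and U: "U \<in> gauge_cocycles free_algebra \<gamma>"
  shows "\<exists>\<kappa>. \<forall>t\<ge>0. U t = (\<lambda>\<xi>. exp (\<kappa> * of_real t) *\<^sub>C \<xi>)"
proof -
  have endo: "normal_unital_star_endo free_algebra (\<gamma> t)" if "0 \<le> t" for t
    using \<gamma> that by (simp add: is_free_flow_def E0_semigroup_def)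
  have shift: "\<gamma> t (semicircular f) = semicircular (right_shift t f)" if "0 \<le> t" "f \<in> L2" for t f
    using \<gamma> that by (simp add: is_free_flow_def)
  have coc: "cocycle free_algebra \<gamma> U" using U by (simp add: gauge_cocycles_def)
  have "\<exists>c. U t = (\<lambda>\<xi>. c *\<^sub>C \<xi>)" if t: "0 \<le> t" for t
  proof -
    have Ut: "U t \<in> free_algebra" "U t \<in> commutant (\<gamma> t ` free_algebra)"
      using U t by (auto simp: gauge_cocycles_def)
    have comm: "U t \<circ> semicircular (right_shift t (unit_block v n))
        = semicircular (right_shift t (unit_block v n)) \<circ> U t" for n
    proof -
      have "\<gamma> t (semicircular (unit_block v n)) \<in> \<gamma> t ` free_algebra"
        by (intro imageI semicircular_in_free_algebra unit_block_L2)
      then show ?thesis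
        using Ut(2) unfolding commutant_def shift[OF t unit_block_L2] by blast
    qed
    obtain c where "U t = (\<lambda>\<xi>. c *\<^sub>C \<xi>)"
      by (rule relative_commutant_scalar[OF Ut(1) right_shift_unit_block_L2[OF t]
            right_shift_unit_block_orthonormal[OF v t] comm])
    then show ?thesis by blast
  qed
  then have "\<exists>c. \<forall>t\<ge>0. U t = (\<lambda>\<xi>. c t *\<^sub>C \<xi>)" by metis
  then obtain c where c: "\<And>t. 0 \<le> t \<Longrightarrow> U t = (\<lambda>\<xi>. c t *\<^sub>C \<xi>)" by blast
  have "continuous_on {0..} (\<lambda>t. U t \<Omega>)" using coc by (simp add: cocycle_def)
  \<comment> \<open>The scalar is the matrix coefficient at the vacuum, so strong continuity makes
    it continuous.\<close>
  then have "continuous_on {0..} (\<lambda>t. cinner \<Omega> (U t \<Omega>))" by (intro continuous_intros)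
  then have cont: "continuous_on {0..} c"
    by (rule continuous_on_eq) (simp add: c cinner_scaleC_right cinner_vacuum)
  \<comment> \<open>Unital linear maps fix scalars, which turns the cocycle identity into
    multiplicativity.\<close>
  have scal: "\<gamma> s (\<lambda>\<xi>. d *\<^sub>C \<xi>) = (\<lambda>\<xi>. d *\<^sub>C \<xi>)" if s: "0 \<le> s" for s d
  proof -
    have "\<gamma> s (\<lambda>\<xi>. d *\<^sub>C id \<xi>) = (\<lambda>\<xi>. d *\<^sub>C \<gamma> s id \<xi>)" "\<gamma> s id = id"
      using endo[OF s] id_in_free_algebra unfolding normal_unital_star_endo_def by blast+
    then show ?thesis by simp
  qed
  have mult: "c (s + t) = c s * c t" if st: "0 \<le> s" "0 \<le> t" for s t
  proof -
    have "U s \<circ> \<gamma> s (U t) = U (s + t)" using coc st by (simp add: cocycle_def)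
    then have "(\<lambda>\<xi>. (c s * c t) *\<^sub>C \<xi> :: 'k fock) = (\<lambda>\<xi>. c (s + t) *\<^sub>C \<xi>)"
      using st by (simp add: c scal o_def scaleC_scaleC)
    then show ?thesis by (simp only: scaleC_fun_eq_iff)
  qed
  \<comment> \<open>Unitarity at time 0 excludes the zero solution of the functional
    equation.\<close>
  have "c 0 \<noteq> 0"
  proof
    assume 0: "c 0 = 0"
    have "U 0 \<circ> hadj (U 0) = id" using coc by (simp add: cocycle_def)
    then have "U 0 (hadj (U 0) \<Omega>) = \<Omega>" by (metis comp_apply id_apply)
    then have "(\<Omega> :: 'k fock) = 0" by (simp add: c 0)
    then show False using cinner_vacuum[where 'k = 'k] by simp
  qed
  then obtain \<kappa> where "\<And>t. 0 \<le> t \<Longrightarrow> c t = exp (\<kappa> * of_real t)"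
    using continuous_character_exp[OF cont mult] by blast
  then show ?thesis using c by auto
qed

text \<open>The product of the adjoint of \<open>U t\<close> with \<open>V t\<close> is a scalar
  equal to its own vacuum trace; \<open>exp_eq_on_halfline_imp_eq\<close> makes the exponent
  unique.\<close>

lemma c_star_scalar:
  assumes U: "\<And>t. 0 \<le> t \<Longrightarrow> U t = (\<lambda>\<xi>. exp (\<kappa> * of_real t) *\<^sub>C \<xi>)"
    and V: "\<And>t. 0 \<le> t \<Longrightarrow> V t = (\<lambda>\<xi>. exp (\<mu> * of_real t) *\<^sub>C \<xi>)"
  shows "c_star (vacuum_trace :: ('k::{real_inner,polish_space} fock \<Rightarrow> 'k fock) \<Rightarrow> complex) U V = cnj \<kappa> + \<mu>"
proof -
  have tr: "vacuum_trace (hadj (U t) \<circ> V t :: 'k fock \<Rightarrow> 'k fock) = exp ((cnj \<kappa> + \<mu>) * of_real t)"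
    if "0 \<le> t" for t
  proof -
    have "hadj (U t) = (\<lambda>\<xi>. cnj (exp (\<kappa> * of_real t)) *\<^sub>C \<xi>)"
      using U[OF that] by (simp add: hadj_eqI[OF is_adjoint_scaleC])
    then show ?thesis
      using V[OF that]
      by (simp add: vacuum_trace_def cinner_scaleC_right cinner_vacuum exp_cnj exp_add[symmetric] algebra_simps)
  qed
  show ?thesis
    unfolding c_star_def
  proof (rule the_equality)
    show "\<forall>t\<ge>0. vacuum_trace (hadj (U t) \<circ> V t) = exp ((cnj \<kappa> + \<mu>) * of_real t)"
      using tr by blast
    fix d assume d: "\<forall>t\<ge>0. vacuum_trace (hadj (U t) \<circ> V t) = exp (d * of_real t)"
    show "d = cnj \<kappa> + \<mu>"
    proof (rule exp_eq_on_halfline_imp_eq)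
      fix t :: real assume t: "0 \<le> t"
      show "exp (d * of_real t) = exp ((cnj \<kappa> + \<mu>) * of_real t)"
        by (rule trans[OF d[rule_format, OF t, symmetric] tr[OF t]])
    qed
  qed
qed

section \<open>Vanishing of the index\<close>

text \<open>Without unit vectors the empty set is the only orthonormal set, so the choice of a basis
  returns it.\<close>

lemma hilbert_dim_eq_0:
  assumes "\<And>x. x \<in> H \<Longrightarrow> ip x x \<noteq> 1"
  shows "hilbert_dim H ip = 0"
proof -
  have on: "orthonormal_in H ip E \<longleftrightarrow> E = {}" for E
    using assms by (auto simp: orthonormal_in_def subset_iff)
  have "orthonormal_basis_of H ip E \<longleftrightarrow> E = {}" for E
    by (auto simp: orthonormal_basis_of_def on)
  then show ?thesis by (simp add: hilbert_dim_def zero_enat_def)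
qed

text \<open>For a zero form all sequences in \<open>V\<close> are Cauchy and equivalent, so the
  completion is a single class, and its inner product with itself is 0.\<close>

lemma hilbert_dim_khilbert_null:
  assumes zero: "(\<lambda>_. 0) \<in> V"
    and diff: "\<And>f g. f \<in> V \<Longrightarrow> g \<in> V \<Longrightarrow> (\<lambda>u. f u - g u) \<in> V"
    and null: "\<And>f g. f \<in> V \<Longrightarrow> g \<in> V \<Longrightarrow> kform K f g = 0"
  shows "hilbert_dim (khilbert V K) (kinner K) = 0"
proof (rule hilbert_dim_eq_0)
  fix p assume p: "p \<in> khilbert V K"
  have norm0: "knorm K (\<lambda>u. f u - g u) = 0" if "f \<in> V" "g \<in> V" for f g
    using null[OF diff[OF that] diff[OF that]] by (simp add: knorm_def)
  have C: "kCauchy V K s \<longleftrightarrow> (\<forall>n. s n \<in> V)" for s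
    by (auto simp: kCauchy_def norm0)
  have "krel V K s t \<longleftrightarrow> (\<forall>n. s n \<in> V) \<and> (\<forall>n. t n \<in> V)" for s t
    by (auto simp: krel_def C norm0)
  then have p: "p = {s. \<forall>n. s n \<in> V}"
    using p by (auto simp: khilbert_def C quotient_def)
  have "(\<lambda>_ _. 0) \<in> p" using zero by (simp add: p)
  then have "(SOME s. s \<in> p) \<in> p" by (rule someI[where P = "\<lambda>s. s \<in> p"])
  then have "kform K ((SOME s. s \<in> p) n) ((SOME s. s \<in> p) n) = 0" for n
    using p by (intro null) auto
  then have "kinner K p p = 0" by (simp add: kinner_def klim_def)
  then show "kinner K p p \<noteq> 1" by simp
qed

lemma sum_zero_functions_diff:
  assumes "f \<in> sum_zero_functions G" "g \<in> sum_zero_functions G"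
  shows "(\<lambda>u. f u - g u) \<in> sum_zero_functions G"
proof -
  let ?A = "{u. f u \<noteq> 0} \<union> {u. g u \<noteq> 0}"
  have fin: "finite ?A" and sub: "?A \<subseteq> G"
    using assms by (auto simp: sum_zero_functions_def finsupp_def)
  have "(\<Sum>u\<in>?A. h u) = (\<Sum>u | h u \<noteq> 0. h u)" if "{u. h u \<noteq> 0} \<subseteq> ?A" for h :: "_ \<Rightarrow> complex"
    using that fin by (intro sum.mono_neutral_right) auto
  \<comment> \<open>The support of the difference may be smaller than the union, so all sums are
    taken over the common set \<open>?A\<close>.\<close>
  note eq = this[of f] this[of g] this[of "\<lambda>u. f u - g u"]
  have s: "{u. f u - g u \<noteq> 0} \<subseteq> ?A" by auto
  have "(\<Sum>u | f u - g u \<noteq> 0. f u - g u) = 0"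
    using assms eq(1,2) eq(3)[OF s, symmetric] by (simp add: sum_subtractf sum_zero_functions_def)
  moreover have "finite {u. f u - g u \<noteq> 0}" "{u. f u - g u \<noteq> 0} \<subseteq> G"
    using finite_subset[OF s fin] s sub by auto
  ultimately show ?thesis by (simp add: sum_zero_functions_def finsupp_def)
qed

text \<open>Each summand of the kernel depends on one variable only, so the double sum splits into
  products, each with the total sum of \<open>g\<close> or the conjugate total sum of
  \<open>f\<close> as a factor.\<close>

lemma kform_additive_kernel_null:
  assumes K: "\<And>u v. u \<in> G \<Longrightarrow> v \<in> G \<Longrightarrow> K u v = cnj (k u) + k v"
    and f: "f \<in> sum_zero_functions G" and g: "g \<in> sum_zero_functions G"
  shows "kform K f g = 0"
proof -
  have "kform K f g = (\<Sum>u | f u \<noteq> 0. \<Sum>v | g v \<noteq> 0. cnj (k u * f u) * g v + cnj (f u) * (k v * g v))"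
    unfolding kform_def using f g
    by (intro sum.cong refl) (auto simp: sum_zero_functions_def finsupp_def subset_iff K algebra_simps)
  also have "\<dots> = cnj (\<Sum>u | f u \<noteq> 0. k u * f u) * (\<Sum>v | g v \<noteq> 0. g v)
      + cnj (\<Sum>u | f u \<noteq> 0. f u) * (\<Sum>v | g v \<noteq> 0. k v * g v)"
    by (simp only: sum.distrib cnj_sum sum_product)
  also have "\<dots> = 0" using f g by (simp add: sum_zero_functions_def)
  finally show ?thesis .
qed

theorem proposition7p9:
  fixes n :: enat
    and \<gamma> :: "real \<Rightarrow> ('k::{real_inner,polish_space} fock \<Rightarrow> 'k fock) \<Rightarrow> ('k fock \<Rightarrow> 'k fock)"
  assumes "1 \<le> n"
    and "hilbert_dim (UNIV :: 'k set) (\<bullet>) = n"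
    and "is_free_flow \<gamma>"
  shows "gauge_index free_algebra vacuum_trace \<gamma> = 0"
proof -
  \<comment> \<open>A space without unit vectors has dimension 0, which contradicts
    \<open>1 \<le> n\<close>.\<close>
  have "\<exists>v::'k. v \<bullet> v = 1"
    using assms(1,2) hilbert_dim_eq_0[of "UNIV :: 'k set" "(\<bullet>)"] by force
  then obtain v :: 'k where v: "norm v = 1" by (auto simp: norm_eq_1)
  let ?G = "gauge_cocycles free_algebra \<gamma>"
  \<comment> \<open>One exponent is chosen for every gauge cocycle, which makes the kernel additive
    on the whole group.\<close>
  have "\<exists>k. \<forall>U\<in>?G. \<forall>t\<ge>0. U t = (\<lambda>\<xi>. exp (k U * of_real t) *\<^sub>C \<xi>)"
    using gauge_cocycle_free_flow[OF v assms(3)] by (intro bchoice) blast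
  then obtain k where k: "\<And>U t. U \<in> ?G \<Longrightarrow> 0 \<le> t \<Longrightarrow> U t = (\<lambda>\<xi>. exp (k U * of_real t) *\<^sub>C \<xi>)"
    by blast
  have "c_star vacuum_trace U V = cnj (k U) + k V" if "U \<in> ?G" "V \<in> ?G" for U V
    using that by (intro c_star_scalar k)
  then have "kform (c_star vacuum_trace) f g = 0"
    if "f \<in> sum_zero_functions ?G" "g \<in> sum_zero_functions ?G" for f g
    using that by (rule kform_additive_kernel_null)
  then show ?thesis
    unfolding gauge_index_def
    by (intro hilbert_dim_khilbert_null sum_zero_functions_diff)
      (simp_all add: sum_zero_functions_def finsupp_def)
qed

end
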